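(* Let $X$ be a separable Banach space and let $f:X\to\mathbb{R}$ be quasiconvex, densely continuous and invariant under the action of a linear periodic map $T$ with no fixed point; that is, $T$ is a bounded linear operator on $X$ with $T^p=I$ for some integer $p>1$, $1$ is not an eigenvalue of $T$ (so that $Tx=x$ if and only if $x=0$), and $f(Tx)=f(x)$ for every $x\in X$. Then $f$ is continuous and Gâteaux differentiable on a dense subset of $X$. If $X$ is reflexive, $f$ is continuous and Gâteaux differentiable on $X$ except at the points of a Haar null set.
   Context: Banach spaces are real. A function $f:X\to\mathbb{R}$ is quasiconvex if $f(\lambda x+(1-\lambda)y)\le\max\{f(x),f(y)\}$ for all $x,y\in X$ and $\lambda\in[0,1]$. It is densely continuous if it is continuous at the points of a dense subset of $X$. $f$ is Gâteaux differentiable at $x$ with derivative $Df(x)\in X^*$ if $Df(x)h=\lim_{t\to0}\frac{f(x+th)-f(x)}{t}$ for every $h\in X$. "Continuous and Gâteaux differentiable on a set" means that both properties hold at each point of that set, as a function on $X$. A Borel set $E\subset X$ is Haar null if there is a Borel probability measure $\mu$ on $X$ with $\mu(x+E)=0$ for every $x\in X$. "A property holds on $X$ except at the points of a Haar null set" means that there is a Haar null set $N$ such that the property holds at every point of $X\setminus N$. *)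

theory Defs
  imports "HOL-Probability.Probability"
begin

definition quasiconvex :: "('a::real_vector \<Rightarrow> real) \<Rightarrow> bool" where
  "quasiconvex f \<longleftrightarrow>
     (\<forall>x y. \<forall>l\<in>{0..1}. f (l *\<^sub>R x + (1 - l) *\<^sub>R y) \<le> max (f x) (f y))"

definition densely_continuous :: "('a::t2_space \<Rightarrow> 'b::topological_space) \<Rightarrow> bool" where
  "densely_continuous f \<longleftrightarrow> closure {x. isCont f x} = UNIV"

definition has_gateaux_derivative ::
    "('a::real_normed_vector \<Rightarrow> real) \<Rightarrow> ('a \<Rightarrow>\<^sub>L real) \<Rightarrow> 'a \<Rightarrow> bool" where
  "has_gateaux_derivative f D x \<longleftrightarrow>
     (\<forall>h. ((\<lambda>t. (f (x + t *\<^sub>R h) - f x) / t) \<longlongrightarrow> blinfun_apply D h) (at 0))"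

definition gateaux_differentiable :: "('a::real_normed_vector \<Rightarrow> real) \<Rightarrow> 'a \<Rightarrow> bool" where
  "gateaux_differentiable f x \<longleftrightarrow> (\<exists>D. has_gateaux_derivative f D x)"

definition haar_null :: "'a::real_normed_vector set \<Rightarrow> bool" where
  "haar_null E \<longleftrightarrow> E \<in> sets borel \<and>
     (\<exists>\<mu>. prob_space \<mu> \<and> sets \<mu> = sets borel \<and> (\<forall>x. emeasure \<mu> ((+) x ` E) = 0))"

definition bidual_embedding :: "'a::real_normed_vector \<Rightarrow> ('a \<Rightarrow>\<^sub>L real) \<Rightarrow>\<^sub>L real" where
  "bidual_embedding x = Blinfun (\<lambda>\<phi>. blinfun_apply \<phi> x)"

text \<open>Since \<open>Blinfun\<close> is unspecified on functions that are not bounded linear, the next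
  lemma is needed to see that \<open>bidual_embedding\<close> is the canonical embedding.\<close>

lemma blinfun_apply_bidual_embedding [simp]:
  "blinfun_apply (bidual_embedding x) \<phi> = blinfun_apply \<phi> x"
  unfolding bidual_embedding_def
  by (simp add: bounded_linear_Blinfun_apply blinfun.bounded_linear_left)

definition reflexive_space :: "'a::real_normed_vector itself \<Rightarrow> bool" where
  "reflexive_space _ \<longleftrightarrow> surj (bidual_embedding :: 'a \<Rightarrow> ('a \<Rightarrow>\<^sub>L real) \<Rightarrow>\<^sub>L real)"

end

theory Submission
  imports Defs
begin

text \<open>
  The sum of the orbit \<open>x, T x, \<dots>, T\<^sup>p\<^sup>-\<^sup>1 x\<close> is fixed by \<open>T\<close> and hence zero. So a \<open>T\<close>-invariant convex
  set that contains \<open>x\<close> contains \<open>0\<close> and \<open>- x / p\<close>, and as soon as it has an interior point it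
  contains a ball around \<open>0\<close>. This applies to the sublevel sets of \<open>f\<close> and of its lower
  semicontinuous hull \<open>g\<close>; in particular \<open>f\<close> attains its minimum at \<open>0\<close>.

  Call a level \<open>a\<close> thin if \<open>{g \<le> a}\<close> has empty interior. Unless they are empty, the sublevel sets
  of the thin levels and their multiples fill a linear subspace. It is a countable union of
  closed sets without interior points, hence proper by Baire's theorem; a line in a direction outside it meets it at most
  once. If \<open>a\<close> is not thin, dense continuity gives \<open>f \<le> a\<close> on a ball around \<open>0\<close>
  (\<open>ball_below_fat_level\<close>), and then quasiconvexity makes \<open>max f a\<close> locally monotone with respect
  to a cone with interior points. At a point outside the subspace such a level can be found
  for which the truncation at \<open>a\<close> is invisible along every line through the point
  (\<open>fat_level_below\<close>).

  On every line \<open>g\<close> is quasiconvex, so decreasing and then increasing, and by Lebesgue's theorem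
  differentiable almost everywhere. Fix a countable dense set \<open>V\<close> of directions that is a vector
  space over the rationals. Where all derivatives \<open>q v\<close> in directions \<open>v \<in> V\<close> exist, \<open>q\<close> is
  homogeneous, odd and quasiconvex, and these three properties force additivity
  (\<open>quasiconvex_homogeneous_imp_additive\<close>); cone monotonicity makes \<open>q\<close> Lipschitz, hence
  extends it to a bounded functional, and squeezes \<open>f\<close> between values of \<open>g\<close> along directions of
  \<open>V\<close>. This gives continuity and Gateaux differentiability of \<open>f\<close>
  (\<open>continuous_gateaux_if_rational_derivatives\<close>).

  The exceptional set is therefore the union of countably many Borel sets, each of which meets
  all lines in one particular direction in null sets. The law of a random series in these
  directions vanishes on all translates of all of them
  (\<open>exists_measure_vanishing_on_null_along\<close>), so the union is Haar null, and the complement of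
  a Haar null set in a separable space is dense.
\<close>

section \<open>Differentiation along rational increments\<close>

text \<open>The increment \<open>t\<close> runs through the rationals only. For a Borel function this makes
  the set of points without a derivative Borel, because every condition on small \<open>t\<close> becomes a
  countable one; along real \<open>t\<close>
  it would involve projections of Borel sets, which need not be Borel.\<close>

definition has_rational_derivative ::
    "('a::real_normed_vector \<Rightarrow> real) \<Rightarrow> 'a \<Rightarrow> real \<Rightarrow> 'a \<Rightarrow> bool" where
  "has_rational_derivative f v D x \<longleftrightarrow>
     ((\<lambda>t. (f (x + t *\<^sub>R v) - f x) / t) \<longlongrightarrow> D) (at 0 within \<rat>)"

lemma at_within_Rats_neq_bot: "at (0::real) within \<rat> \<noteq> bot"
proof -
  have "(0::real) islimpt \<rat>"
    unfolding islimpt_approachable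
  proof (intro allI impI)
    fix e :: real assume "e > 0"
    then obtain q where q: "q \<in> \<rat>" "0 < q" "q < e" using Rats_dense_in_real by blast
    have "q \<noteq> 0 \<and> dist q 0 < e" using q by simp
    then show "\<exists>x'::real\<in>\<rat>. x' \<noteq> 0 \<and> dist x' 0 < e" using q(1) by (rule bexI)
  qed
  then show ?thesis by (simp add: trivial_limit_within)
qed

text \<open>Divergence is split into countably many kinds, unboundedness and oscillation across a
  rational interval, each of which can be shown to be Borel and null separately.\<close>

lemma convergent_iff_no_oscillation:
  fixes g :: "'b \<Rightarrow> real"
  assumes "F \<noteq> bot"
  shows "(\<exists>D. (g \<longlongrightarrow> D) F) \<longleftrightarrow>
    (\<exists>n::nat. \<forall>\<^sub>F x in F. \<bar>g x\<bar> \<le> real n) \<and>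
    (\<forall>a\<in>\<rat>. \<forall>b\<in>\<rat>. a < b \<longrightarrow> \<not> ((\<exists>\<^sub>F x in F. g x < a) \<and> (\<exists>\<^sub>F x in F. b < g x)))"
    (is "?L \<longleftrightarrow> ?R1 \<and> ?R2")
proof
  assume ?L
  then obtain D where D: "(g \<longlongrightarrow> D) F" by blast
  obtain n :: nat where n: "\<bar>D\<bar> < real n" using reals_Archimedean2 by blast
  have "\<forall>\<^sub>F x in F. \<bar>g x\<bar> < real n"
    using order_tendstoD(2)[OF tendsto_rabs[OF D] n] .
  then have ?R1 by (intro exI[of _ n]) (auto elim: eventually_mono)
  moreover have ?R2
  proof (intro ballI impI notI)
    fix a b :: real assume ab: "a < b" and fr: "(\<exists>\<^sub>F x in F. g x < a) \<and> (\<exists>\<^sub>F x in F. b < g x)"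
    show False
    proof (cases "a < D")
      case True
      from order_tendstoD(1)[OF D this] have "\<forall>\<^sub>F x in F. \<not> (g x < a)" by (auto elim: eventually_mono)
      then show False using fr by (simp add: frequently_def)
    next
      case False
      then have "D < b" using ab by simp
      from order_tendstoD(2)[OF D this] have "\<forall>\<^sub>F x in F. \<not> (b < g x)" by (auto elim: eventually_mono)
      then show False using fr by (simp add: frequently_def)
    qed
  qed
  ultimately show "?R1 \<and> ?R2" ..
next
  assume R: "?R1 \<and> ?R2"
  then obtain n :: nat where n: "\<forall>\<^sub>F x in F. \<bar>g x\<bar> \<le> real n" by blast
  define A where "A = {a. \<forall>\<^sub>F x in F. a \<le> g x}"
  have "- real n \<in> A" unfolding A_def using n by (auto elim: eventually_mono)
  then have ne: "A \<noteq> {}" by auto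
  have "a \<le> real n" if "a \<in> A" for a
  proof -
    have "\<forall>\<^sub>F x in F. a \<le> g x" using that by (simp add: A_def)
    with n have "\<forall>\<^sub>F x in F. a \<le> real n" by eventually_elim auto
    then show ?thesis using assms by simp
  qed
  then have bdd: "bdd_above A" by (auto simp: bdd_above_def)
  have "(g \<longlongrightarrow> Sup A) F"
  proof (rule order_tendstoI)
    fix c assume "c < Sup A"
    then obtain a where "a \<in> A" "c < a" using less_cSup_iff[OF ne bdd] by blast
    then show "\<forall>\<^sub>F x in F. c < g x" unfolding A_def by (auto elim: eventually_mono)
  next
    fix c assume c: "Sup A < c"
    obtain b where b: "b \<in> \<rat>" "Sup A < b" "b < c" using c Rats_dense_in_real by blast
    obtain a where a: "a \<in> \<rat>" "Sup A < a" "a < b" using b Rats_dense_in_real by blast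
    have "a \<notin> A" using a(2) cSup_upper[OF _ bdd] by force
    then have "\<exists>\<^sub>F x in F. g x < a" by (simp add: A_def frequently_def not_less)
    then have "\<not> (\<exists>\<^sub>F x in F. b < g x)" using R a b by blast
    then have "\<forall>\<^sub>F x in F. g x \<le> b" by (simp add: frequently_def not_less)
    then show "\<forall>\<^sub>F x in F. g x < c" using b(3) by (auto elim: eventually_mono)
  qed
  then show ?L ..
qed

section \<open>Monotone functions on the line: covering estimates\<close>

text \<open>The measure of this set is the total increase of \<open>f\<close> over \<open>U\<close>: disjoint intervals
  \<open>{c..d}\<close> have disjoint images \<open>{f c<..<f d}\<close> of length \<open>f d - f c\<close>. Working with a set of values
  turns sums of increments into measures, which handles monotone functions with jumps
  as well.\<close>

definition increment_gaps :: "(real \<Rightarrow> real) \<Rightarrow> real set \<Rightarrow> real set" where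
  "increment_gaps f U = (\<Union>{{f c<..<f d} | c d. c < d \<and> {c..d} \<subseteq> U})"

lemma open_increment_gaps: "open (increment_gaps f U)"
  unfolding increment_gaps_def by auto

text \<open>The Vitali covering theorem for closed intervals, where the endpoints, a countable set,
  are discarded so that the selected intervals can be taken open.\<close>

lemma Vitali_intervals:
  fixes E U :: "real set" and P :: "real \<Rightarrow> real \<Rightarrow> bool"
  assumes U: "open U" "E \<subseteq> U"
    and small: "\<And>x \<delta>. x \<in> E \<Longrightarrow> \<delta> > 0 \<Longrightarrow>
        \<exists>c d. c < d \<and> c \<le> x \<and> x \<le> d \<and> d - c < \<delta> \<and> P c d"
  obtains C where "countable C" "\<And>c d. (c, d) \<in> C \<Longrightarrow> c < d \<and> {c..d} \<subseteq> U \<and> P c d"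
    "disjoint_family_on (\<lambda>(c, d). {c<..<d}) C"
    "negligible (E - (\<Union>(c, d)\<in>C. {c<..<d}))"
proof -
  define K where "K = {(c, d). c < d \<and> {c..d} \<subseteq> U \<and> P c d}"
  define a where "a = (\<lambda>(c, d). (c + d) / 2 :: real)"
  define r where "r = (\<lambda>(c, d). (d - c) / 2 :: real)"
  have cball: "cball (a i) (r i) = {fst i..snd i}" for i
    by (auto simp: a_def r_def dist_real_def field_simps abs_if split: prod.split if_splits)
  obtain C where C: "countable C" "C \<subseteq> K"
    "pairwise (\<lambda>i j. disjnt (cball (a i) (r i)) (cball (a j) (r j))) C"
    "negligible (E - (\<Union>i \<in> C. cball (a i) (r i)))"
  proof (rule Vitali_covering_theorem_cballs[of K r E a])
    show "0 < r i" if "i \<in> K" for i using that by (auto simp: K_def r_def)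
    fix x d :: real assume x: "x \<in> E" and d: "0 < d"
    obtain e where e: "e > 0" "ball x e \<subseteq> U" using U x open_contains_ball by blast
    have "min d e > 0" using d e by simp
    from small[OF x this] obtain c d' where
      cd: "c < d'" "c \<le> x" "x \<le> d'" "d' - c < min d e" "P c d'" by blast
    have "{c..d'} \<subseteq> U" using cd e(2) by (auto simp: subset_iff dist_real_def)
    then have "(c, d') \<in> K" using cd by (simp add: K_def)
    moreover have "x \<in> cball (a (c, d')) (r (c, d'))" unfolding cball using cd by simp
    moreover have "r (c, d') < d" using cd d by (simp add: r_def)
    ultimately show "\<exists>i. i \<in> K \<and> x \<in> cball (a i) (r i) \<and> r i < d" by blast
  qed
  show thesis
  proof (rule that[OF C(1)])
    show "c < d \<and> {c..d} \<subseteq> U \<and> P c d" if "(c, d) \<in> C" for c d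
      using C(2) that by (auto simp: K_def)
    show "disjoint_family_on (\<lambda>(c, d). {c<..<d}) C"
      unfolding disjoint_family_on_def
    proof (intro ballI impI)
      fix i j assume ij: "i \<in> C" "j \<in> C" "i \<noteq> j"
      then have "{fst i..snd i} \<inter> {fst j..snd j} = {}"
        using C(3) unfolding cball pairwise_def disjnt_def by blast
      then show "(case i of (c, d) \<Rightarrow> {c<..<d}) \<inter> (case j of (c, d) \<Rightarrow> {c<..<d}) = {}"
        by (fastforce simp: case_prod_unfold)
    qed
    have "negligible (fst ` C \<union> snd ` C)"
      using C(1) countable_imp_null_set_lborel[of "fst ` C \<union> snd ` C"]
      by (simp add: negligible_iff_null_sets null_sets_completionI)
    then have "negligible ((E - (\<Union>i \<in> C. cball (a i) (r i))) \<union> (fst ` C \<union> snd ` C))"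
      using C(4) negligible_Un by blast
    then show "negligible (E - (\<Union>(c, d)\<in>C. {c<..<d}))"
      by (rule negligible_subset) (force simp: cball case_prod_unfold image_iff)
  qed
qed

lemma emeasure_Union_intervals:
  fixes C :: "(real \<times> real) set"
  assumes "countable C" "\<And>c d. (c, d) \<in> C \<Longrightarrow> g c \<le> g d"
    and "disjoint_family_on (\<lambda>(c, d). {g c<..<g d}) C"
  shows "emeasure lborel (\<Union>(c, d)\<in>C. {g c<..<g d}) =
    (\<integral>\<^sup>+ i. ennreal (g (snd i) - g (fst i)) \<partial>count_space C)"
proof -
  have "emeasure lborel (\<Union>i\<in>C. (\<lambda>(c, d). {g c<..<g d}) i) =
      (\<integral>\<^sup>+ i. emeasure lborel ((\<lambda>(c, d). {g c<..<g d}) i) \<partial>count_space C)"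
    by (rule emeasure_UN_countable) (use assms in auto)
  also have "\<dots> = (\<integral>\<^sup>+ i. ennreal (g (snd i) - g (fst i)) \<partial>count_space C)"
    by (rule nn_integral_cong) (use assms(2) in auto)
  finally show ?thesis .
qed

lemma disjoint_family_on_image_gaps:
  fixes f :: "real \<Rightarrow> real"
  assumes "mono f" "disjoint_family_on (\<lambda>(c, d). {c<..<d}) C"
    and "\<And>c d. (c, d) \<in> C \<Longrightarrow> c < d"
  shows "disjoint_family_on (\<lambda>(c, d). {f c<..<f d}) C"
  unfolding disjoint_family_on_def
proof (intro ballI impI)
  fix i j assume ij: "i \<in> C" "j \<in> C" "i \<noteq> j"
  obtain c d c' d' where eq: "i = (c, d)" "j = (c', d')" by fastforce
  have lt: "c < d" "c' < d'" using ij assms(3) by (auto simp: eq)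
  have "{c<..<d} \<inter> {c'<..<d'} = {}"
    using assms(2) ij by (force simp: disjoint_family_on_def eq)
  then have "max c c' \<ge> min d d'"
    by (metis Int_greaterThanLessThan dense greaterThanLessThan_empty_iff not_less)
  then have "d \<le> c' \<or> d' \<le> c" using lt by linarith
  then have "f d \<le> f c' \<or> f d' \<le> f c" using assms(1) by (auto dest: monoD)
  then show "(case i of (c, d) \<Rightarrow> {f c<..<f d}) \<inter> (case j of (c, d) \<Rightarrow> {f c<..<f d}) = {}"
    by (auto simp: eq)
qed

text \<open>Where \<open>f\<close> has arbitrarily short chords of slope at least \<open>b\<close>, a Vitali selection of such
  chords covers almost all of \<open>E\<close>, and its image has measure at least \<open>b\<close> times as large.\<close>

lemma emeasure_le_increment_gaps:
  fixes f :: "real \<Rightarrow> real"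
  assumes "mono f" "open U" "E \<subseteq> U" "E \<in> sets borel" "b \<ge> 0"
    and small: "\<And>x \<delta>. x \<in> E \<Longrightarrow> \<delta> > 0 \<Longrightarrow>
        \<exists>c d. c < d \<and> c \<le> x \<and> x \<le> d \<and> d - c < \<delta> \<and> b * (d - c) \<le> f d - f c"
  shows "ennreal b * emeasure lborel E \<le> emeasure lborel (increment_gaps f U)"
proof -
  obtain C where C: "countable C"
      "\<And>c d. (c, d) \<in> C \<Longrightarrow> c < d \<and> {c..d} \<subseteq> U \<and> b * (d - c) \<le> f d - f c"
      "disjoint_family_on (\<lambda>(c, d). {c<..<d}) C"
      "negligible (E - (\<Union>(c, d)\<in>C. {c<..<d}))"
    by (rule Vitali_intervals[OF assms(2,3), of "\<lambda>c d. b * (d - c) \<le> f d - f c"])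
      (use small in blast)+
  let ?W = "\<Union>(c, d)\<in>C. {c<..<d}"
  have fC: "f c \<le> f d" if "(c, d) \<in> C" for c d
    using C(2)[OF that] assms(1) by (simp add: monoD)
  have Wb: "?W \<in> sets borel" by (intro borel_open) auto
  have null: "emeasure lborel (E - ?W) = 0"
    using C(4) assms(4) Wb null_sets_completion_iff[of "E - ?W" lborel]
    by (simp add: negligible_iff_null_sets null_sets_def)
  have "emeasure lborel E \<le> emeasure lborel ((E - ?W) \<union> ?W)"
    using assms(4) Wb by (intro emeasure_mono) auto
  also have "\<dots> \<le> emeasure lborel (E - ?W) + emeasure lborel ?W"
    using assms(4) Wb by (intro emeasure_subadditive) auto
  also have "\<dots> = emeasure lborel ?W" using null by simp
  also have "\<dots> = (\<integral>\<^sup>+ i. ennreal (snd i - fst i) \<partial>count_space C)"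
    using emeasure_Union_intervals[of C "\<lambda>x. x"] C by fastforce
  finally have "ennreal b * emeasure lborel E \<le>
      ennreal b * (\<integral>\<^sup>+ i. ennreal (snd i - fst i) \<partial>count_space C)"
    by (rule mult_left_mono) simp
  also have "\<dots> = (\<integral>\<^sup>+ i. ennreal b * ennreal (snd i - fst i) \<partial>count_space C)"
    by (subst nn_integral_cmult) auto
  also have "\<dots> \<le> (\<integral>\<^sup>+ i. ennreal (f (snd i) - f (fst i)) \<partial>count_space C)"
  proof (rule nn_integral_mono)
    fix i assume "i \<in> space (count_space C)"
    then show "ennreal b * ennreal (snd i - fst i) \<le> ennreal (f (snd i) - f (fst i))"
      using C(2)[of "fst i" "snd i"] assms(5) by (simp add: ennreal_mult'[symmetric] ennreal_leI)
  qed
  also have "\<dots> = emeasure lborel (\<Union>(c, d)\<in>C. {f c<..<f d})"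
    using C(1) fC disjoint_family_on_image_gaps[OF assms(1) C(3)] C(2)
    by (intro emeasure_Union_intervals[symmetric]) blast+
  also have "\<dots> \<le> emeasure lborel (increment_gaps f U)"
  proof (rule emeasure_mono)
    show "(\<Union>(c, d)\<in>C. {f c<..<f d}) \<subseteq> increment_gaps f U"
    proof
      fix y assume "y \<in> (\<Union>(c, d)\<in>C. {f c<..<f d})"
      then obtain c d where "(c, d) \<in> C" "y \<in> {f c<..<f d}" by blast
      then show "y \<in> increment_gaps f U" using C(2) unfolding increment_gaps_def by blast
    qed
  qed (simp add: open_increment_gaps)
  finally show ?thesis .
qed

text \<open>The counterpart for slopes at most \<open>a\<close>. Here the selected intervals themselves form the
  open set \<open>W\<close>: an interval inside a disjoint union of open intervals lies in one of them,
  so \<open>f\<close> increases over \<open>W\<close> by no more than the sum of the selected increments.\<close>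

lemma increment_gaps_small_on_cover:
  fixes f :: "real \<Rightarrow> real"
  assumes "mono f" "open U" "E \<subseteq> U" "a \<ge> 0"
    and small: "\<And>x \<delta>. x \<in> E \<Longrightarrow> \<delta> > 0 \<Longrightarrow>
        \<exists>c d. c < d \<and> c \<le> x \<and> x \<le> d \<and> d - c < \<delta> \<and> f d - f c \<le> a * (d - c)"
  obtains W where "open W" "W \<subseteq> U" "negligible (E - W)"
    "emeasure lborel (increment_gaps f W) \<le> ennreal a * emeasure lborel U"
proof -
  obtain C where C: "countable C"
      "\<And>c d. (c, d) \<in> C \<Longrightarrow> c < d \<and> {c..d} \<subseteq> U \<and> f d - f c \<le> a * (d - c)"
      "disjoint_family_on (\<lambda>(c, d). {c<..<d}) C"
      "negligible (E - (\<Union>(c, d)\<in>C. {c<..<d}))"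
    by (rule Vitali_intervals[OF assms(2,3), of "\<lambda>c d. f d - f c \<le> a * (d - c)"])
      (use small in blast)+
  let ?W = "\<Union>(c, d)\<in>C. {c<..<d}"
  have fC: "f c \<le> f d" if "(c, d) \<in> C" for c d
    using C(2)[OF that] assms(1) by (simp add: monoD)
  have oW: "open ?W" by auto
  have WU: "?W \<subseteq> U" using C(2) by fastforce
  have "increment_gaps f ?W \<subseteq> (\<Union>(c, d)\<in>C. {f c<..<f d})"
  proof
    fix y assume "y \<in> increment_gaps f ?W"
    then obtain c' d' where y: "y \<in> {f c'<..<f d'}" "c' < d'" "{c'..d'} \<subseteq> ?W"
      unfolding increment_gaps_def by auto
    then have "c' \<in> ?W" by (meson atLeastAtMost_iff less_imp_le order_refl subsetD)
    then obtain c d where cd: "(c, d) \<in> C" "c < c'" "c' < d" by auto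
    \<comment> \<open>A segment inside the union cannot leave a component, since the endpoint of a component is not covered.\<close>
    have "d' < d"
    proof (rule ccontr)
      assume "\<not> d' < d"
      then have "d \<in> {c'..d'}" using cd by auto
      then have "d \<in> ?W" using y(3) by blast
      then obtain c2 d2 where 2: "(c2, d2) \<in> C" "c2 < d" "d < d2" by auto
      then have ne: "(c2, d2) \<noteq> (c, d)" by auto
      obtain z where "max c c2 < z" "z < d" using dense[of "max c c2" d] cd 2 by auto
      then have "z \<in> {c<..<d} \<inter> {c2<..<d2}" using 2 by auto
      then show False using C(3) ne 2(1) cd(1) by (force simp: disjoint_family_on_def)
    qed
    then have "f c \<le> f c'" "f d' \<le> f d"
      using cd monoD[OF assms(1), of c c'] monoD[OF assms(1), of d' d] by simp_all
    then have "y \<in> {f c<..<f d}" using y(1) by simp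
    then show "y \<in> (\<Union>(c, d)\<in>C. {f c<..<f d})" using cd(1) by blast
  qed
  moreover have "open (\<Union>(c, d)\<in>C. {f c<..<f d})" by auto
  ultimately have "emeasure lborel (increment_gaps f ?W) \<le> emeasure lborel (\<Union>(c, d)\<in>C. {f c<..<f d})"
    by (intro emeasure_mono) simp_all
  also have "\<dots> = (\<integral>\<^sup>+ i. ennreal (f (snd i) - f (fst i)) \<partial>count_space C)"
    using C(1) fC disjoint_family_on_image_gaps[OF assms(1) C(3)] C(2)
    by (intro emeasure_Union_intervals) blast+
  also have "\<dots> \<le> (\<integral>\<^sup>+ i. ennreal a * ennreal (snd i - fst i) \<partial>count_space C)"
  proof (rule nn_integral_mono)
    fix i assume "i \<in> space (count_space C)"
    then show "ennreal (f (snd i) - f (fst i)) \<le> ennreal a * ennreal (snd i - fst i)"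
      using C(2)[of "fst i" "snd i"] assms(4) by (simp add: ennreal_mult'[symmetric] ennreal_leI)
  qed
  also have "\<dots> = ennreal a * (\<integral>\<^sup>+ i. ennreal (snd i - fst i) \<partial>count_space C)"
    by (rule nn_integral_cmult) auto
  also have "\<dots> = ennreal a * emeasure lborel ?W"
    using emeasure_Union_intervals[of C "\<lambda>x. x"] C by fastforce
  also have "\<dots> \<le> ennreal a * emeasure lborel U"
    using WU assms(2) by (intro mult_left_mono emeasure_mono) auto
  finally show thesis using that[OF oW WU C(4)] by blast
qed

section \<open>Lebesgue's differentiation theorem\<close>

lemma frequently_rational_quotient_imp_interval:
  fixes f :: "real \<Rightarrow> real"
  assumes "\<exists>\<^sub>F t in at 0 within \<rat>. P ((f (x + t) - f x) / t)" "\<delta> > 0"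
  obtains c d where "c < d" "c \<le> x" "x \<le> d" "d - c < \<delta>" "P ((f d - f c) / (d - c))"
proof -
  obtain t where t: "t \<noteq> 0" "\<bar>t\<bar> < \<delta>" "P ((f (x + t) - f x) / t)"
    using assms unfolding frequently_at by (auto simp: dist_real_def)
  show thesis
  proof (cases "t > 0")
    case True
    then show thesis using t by (intro that[of x "x + t"]) auto
  next
    case False
    have "(f (x + t) - f x) / t = (f x - f (x + t)) / (x - (x + t))"
      using t(1) by (simp add: field_simps)
    then show thesis using t False by (intro that[of "x + t" x]) auto
  qed
qed

lemma frequently_rational_iff:
  "(\<exists>\<^sub>F t in at 0 within \<rat>. P t) \<longleftrightarrow> (\<forall>n. \<exists>q. q \<noteq> 0 \<and> \<bar>real_of_rat q\<bar> < 1 / real (Suc n) \<and> P (real_of_rat q))"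
proof (intro iffI allI)
  fix n assume "\<exists>\<^sub>F t in at 0 within \<rat>. P t"
  moreover have "1 / real (Suc n) > 0" by simp
  ultimately obtain t where "t \<in> \<rat>" "t \<noteq> 0" "\<bar>t\<bar> < 1 / real (Suc n)" "P t"
    unfolding frequently_at dist_real_def diff_0_right by blast
  then show "\<exists>q. q \<noteq> 0 \<and> \<bar>real_of_rat q\<bar> < 1 / real (Suc n) \<and> P (real_of_rat q)"
    by (auto elim!: Rats_cases)
next
  assume *: "\<forall>n. \<exists>q. q \<noteq> 0 \<and> \<bar>real_of_rat q\<bar> < 1 / real (Suc n) \<and> P (real_of_rat q)"
  show "\<exists>\<^sub>F t in at 0 within \<rat>. P t"
    unfolding frequently_at
  proof (intro allI impI)
    fix d :: real assume "d > 0"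
    then obtain n where n: "1 / real (Suc n) < d" using nat_approx_posE by blast
    obtain q where q: "q \<noteq> 0" "\<bar>real_of_rat q\<bar> < 1 / real (Suc n)" "P (real_of_rat q)"
      using * by blast
    then have "real_of_rat q \<noteq> 0 \<and> dist (real_of_rat q) 0 < d \<and> P (real_of_rat q)"
      using n by simp
    then show "\<exists>x\<in>\<rat>. x \<noteq> 0 \<and> dist x 0 < d \<and> P x" by (rule bexI) simp
  qed
qed

lemma sets_borel_frequently_rational:
  fixes P :: "'a::topological_space \<Rightarrow> real \<Rightarrow> bool"
  assumes "\<And>t. {x. P x t} \<in> sets borel"
  shows "{x. \<exists>\<^sub>F t in at 0 within \<rat>. P x t} \<in> sets borel"
proof -
  have "{x. \<exists>\<^sub>F t in at 0 within \<rat>. P x t} =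
     (\<Inter>n. \<Union>q\<in>{q. q \<noteq> 0 \<and> \<bar>real_of_rat q\<bar> < 1 / real (Suc n)}. {x. P x (real_of_rat q)})"
    by (auto simp: frequently_rational_iff)
  also have "\<dots> \<in> sets borel" using assms by (intro sets.countable_INT' sets.countable_UN') auto
  finally show ?thesis .
qed

text \<open>Slopes larger than \<open>n\<close> near every point of \<open>E\<close> force \<open>n\<close> times the measure of \<open>E\<close> to be
  at most the total increase of \<open>f\<close> over a bounded interval, for every \<open>n\<close>.\<close>

lemma monotone_upper_quotients_infinite_null:
  fixes f :: "real \<Rightarrow> real"
  assumes f: "mono f" and E: "E \<in> sets borel" "E \<subseteq> {-k<..<k}"
    and inf: "\<And>x n. x \<in> E \<Longrightarrow> \<exists>\<^sub>F t in at 0 within \<rat>. real n < (f (x + t) - f x) / t"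
  shows "emeasure lborel E = 0"
proof -
  have sub: "increment_gaps f {-k<..<k} \<subseteq> {f (-k)..f k}"
  proof
    fix y assume "y \<in> increment_gaps f {-k<..<k}"
    then obtain c d where "y \<in> {f c<..<f d}" "c < d" "{c..d} \<subseteq> {-k<..<k}"
      unfolding increment_gaps_def by blast
    moreover from this have "c \<in> {-k<..<k}" "d \<in> {-k<..<k}" by (meson atLeastAtMost_iff less_imp_le order_refl subsetD)+
    then have "-k \<le> c" "d \<le> k" by simp_all
    ultimately show "y \<in> {f (-k)..f k}" using monoD[OF f, of "-k" c] monoD[OF f, of d k] by simp
  qed
  have bound: "ennreal (real n) * emeasure lborel E \<le> ennreal (f k - f (-k))" for n
  proof -
    have "ennreal (real n) * emeasure lborel E \<le> emeasure lborel (increment_gaps f {-k<..<k})"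
    proof (rule emeasure_le_increment_gaps[OF f _ E(2,1)])
      fix x \<delta> :: real assume x: "x \<in> E" "\<delta> > 0"
      obtain c d where cd: "c < d" "c \<le> x" "x \<le> d" "d - c < \<delta>" "real n < (f d - f c) / (d - c)"
        using frequently_rational_quotient_imp_interval[OF inf[OF x(1)] x(2)] .
      then have "real n * (d - c) \<le> f d - f c" by (simp add: field_simps)
      then show "\<exists>c d. c < d \<and> c \<le> x \<and> x \<le> d \<and> d - c < \<delta> \<and> real n * (d - c) \<le> f d - f c"
        using cd by blast
    qed auto
    also have "\<dots> \<le> emeasure lborel {f (-k)..f k}" using sub by (intro emeasure_mono) auto
    also have "\<dots> \<le> ennreal (f k - f (-k))"
      by (cases "f (-k) \<le> f k") auto
    finally show ?thesis .
  qed
  have "emeasure lborel E \<le> emeasure lborel {-k<..<k}" using E by (intro emeasure_mono) auto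
  also have "\<dots> < \<infinity>" by (cases "-k \<le> k") auto
  finally obtain m where m: "emeasure lborel E = ennreal m" "m \<ge> 0"
    by (cases "emeasure lborel E") auto
  have "real n * m \<le> max 0 (f k - f (-k))" for n
  proof -
    have "ennreal (real n * m) \<le> ennreal (max 0 (f k - f (-k)))"
      using bound[of n] m by (simp add: ennreal_mult' ennreal_max_0)
    then show ?thesis by (subst (asm) ennreal_le_iff) auto
  qed
  then have "\<not> m > 0" using ex_less_of_nat_mult[of m "max 0 (f k - f (-k))"] by (meson not_less)
  then show ?thesis using m by simp
qed

text \<open>Cover \<open>E\<close> tightly by an open \<open>U\<close>. Small slopes give an open \<open>W\<close> that contains almost all of
  \<open>E\<close> and over which \<open>f\<close> increases by at most \<open>a\<close> times the measure of \<open>U\<close>; large slopes, used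
  inside \<open>W\<close>, show that this increase is at least \<open>b\<close> times the measure of \<open>E\<close>. As \<open>a < b\<close>, the
  measure is zero.\<close>

lemma monotone_oscillating_quotients_null:
  fixes f :: "real \<Rightarrow> real"
  assumes f: "mono f" and E: "E \<in> sets borel" "E \<subseteq> {-k<..<k}" and ab: "a < b"
    and low: "\<And>x. x \<in> E \<Longrightarrow> \<exists>\<^sub>F t in at 0 within \<rat>. (f (x + t) - f x) / t < a"
    and high: "\<And>x. x \<in> E \<Longrightarrow> \<exists>\<^sub>F t in at 0 within \<rat>. b < (f (x + t) - f x) / t"
  shows "emeasure lborel E = 0"
proof (cases "E = {}")
  case False
  then obtain x0 where "x0 \<in> E" by blast
  from low[OF this] obtain c d where "c < d" "c \<le> x0" "x0 \<le> d" "d - c < 1" "(f d - f c) / (d - c) < a"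
    by (rule frequently_rational_quotient_imp_interval[where \<delta> = 1]) simp_all
  then have a: "a > 0" using monoD[OF f, of c d]
    by (meson diff_ge_0_iff_ge diff_gt_0_iff_gt divide_nonneg_pos less_imp_le less_le_trans not_le)
  have "emeasure lborel E \<le> emeasure lborel {-k<..<k}" using E by (intro emeasure_mono) auto
  also have "\<dots> < \<infinity>" by (cases "-k \<le> k") auto
  finally obtain m where m: "emeasure lborel E = ennreal m" "m \<ge> 0"
    by (cases "emeasure lborel E") auto
  have "b * m \<le> a * (m + \<epsilon>)" if "\<epsilon> > 0" for \<epsilon>
  proof -
    have El: "E \<in> sets lebesgue" using E(1) by simp
    obtain U where U: "open U" "E \<subseteq> U" "emeasure lebesgue (U - E) < ennreal \<epsilon>"
      by (rule sets_lebesgue_outer_open[OF El \<open>\<epsilon> > 0\<close>])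
    have Ub: "U \<in> sets borel" using U(1) by simp
    have "emeasure lborel U = emeasure lborel (E \<union> (U - E))" using U(2) by (simp add: Un_absorb1)
    also have "\<dots> \<le> emeasure lborel E + emeasure lborel (U - E)"
      using E(1) Ub by (intro emeasure_subadditive) auto
    also have "\<dots> \<le> ennreal m + ennreal \<epsilon>"
      using U(3) E(1) Ub by (intro add_mono) (auto simp: m)
    finally have U_small: "emeasure lborel U \<le> ennreal (m + \<epsilon>)" using m that by simp
    obtain W where W: "open W" "W \<subseteq> U" "negligible (E - W)"
      "emeasure lborel (increment_gaps f W) \<le> ennreal a * emeasure lborel U"
    proof (rule increment_gaps_small_on_cover[OF f U(1,2), of a])
      fix x \<delta> :: real assume x: "x \<in> E" "\<delta> > 0"
      obtain c d where cd: "c < d" "c \<le> x" "x \<le> d" "d - c < \<delta>" "(f d - f c) / (d - c) < a"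
        using frequently_rational_quotient_imp_interval[OF low[OF x(1)] x(2)] .
      then have "f d - f c \<le> a * (d - c)" by (simp add: field_simps)
      then show "\<exists>c d. c < d \<and> c \<le> x \<and> x \<le> d \<and> d - c < \<delta> \<and> f d - f c \<le> a * (d - c)"
        using cd by blast
    qed (use a in auto)
    have Wb: "W \<in> sets borel" using W(1) by simp
    have null: "E - W \<in> null_sets lborel"
      using W(3) E(1) Wb null_sets_completion_iff[of "E - W" lborel]
      by (simp add: negligible_iff_null_sets)
    have "emeasure lborel E = emeasure lborel (E - (E - W))"
      using emeasure_Diff_null_set[OF null] E(1) by simp
    also have "E - (E - W) = E \<inter> W" by blast
    finally have EW: "emeasure lborel (E \<inter> W) = ennreal m" using m by simp
    have "ennreal b * emeasure lborel (E \<inter> W) \<le> emeasure lborel (increment_gaps f W)"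
    proof (rule emeasure_le_increment_gaps[OF f W(1)])
      fix x \<delta> :: real assume x: "x \<in> E \<inter> W" "\<delta> > 0"
      then have "x \<in> E" by simp
      obtain c d where cd: "c < d" "c \<le> x" "x \<le> d" "d - c < \<delta>" "b < (f d - f c) / (d - c)"
        using frequently_rational_quotient_imp_interval[OF high[OF \<open>x \<in> E\<close>] x(2)] .
      then have "b * (d - c) \<le> f d - f c" by (simp add: field_simps)
      then show "\<exists>c d. c < d \<and> c \<le> x \<and> x \<le> d \<and> d - c < \<delta> \<and> b * (d - c) \<le> f d - f c"
        using cd by blast
    qed (use E(1) Wb a ab in auto)
    also have "\<dots> \<le> ennreal a * ennreal (m + \<epsilon>)"
      using W(4) U_small by (meson mult_left_mono order_trans zero_le)
    finally have "ennreal (b * m) \<le> ennreal (a * (m + \<epsilon>))"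
      using EW m a ab that by (simp add: ennreal_mult')
    then show ?thesis using a m that by (subst (asm) ennreal_le_iff) auto
  qed
  then have "b * m - a * m \<le> a * \<epsilon>" if "\<epsilon> > 0" for \<epsilon> using that by (simp add: algebra_simps)
  then have "(b - a) * m / a \<le> 0 + \<epsilon>" if "\<epsilon> > 0" for \<epsilon> using that a by (simp add: field_simps)
  then have "(b - a) * m / a \<le> 0" by (rule field_le_epsilon)
  then have "(b - a) * m \<le> 0" using a by (simp add: divide_le_0_iff)
  then have "m \<le> 0" using ab by (simp add: mult_le_0_iff)
  then show ?thesis using m by simp
qed simp

lemma sets_borel_no_rational_derivative:
  fixes f :: "'a::real_normed_vector \<Rightarrow> real"
  assumes f: "f \<in> borel_measurable borel"
  shows "{x. \<not> (\<exists>D. has_rational_derivative f v D x)} \<in> sets borel"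
proof -
  let ?Q = "\<lambda>x t. (f (x + t *\<^sub>R v) - f x) / t"
  have "(\<lambda>x. x + t *\<^sub>R v) \<in> borel_measurable borel" for t
    by (intro borel_measurable_continuous_onI continuous_intros)
  then have "(\<lambda>x. f (x + t *\<^sub>R v)) \<in> borel_measurable borel" for t
    using measurable_compose f by blast
  then have Q[measurable]: "(\<lambda>x. ?Q x t) \<in> borel_measurable borel" for t using f by simp
  have S: "{x. c < ?Q x t} \<in> sets borel" "{x. ?Q x t < c} \<in> sets borel" "{x. c < \<bar>?Q x t\<bar>} \<in> sets borel" for c t
    by measurable
  have "{x. \<not> (\<exists>D. has_rational_derivative f v D x)} =
     (\<Inter>n::nat. {x. \<exists>\<^sub>F t in at 0 within \<rat>. real n < \<bar>?Q x t\<bar>}) \<union>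
     (\<Union>a\<in>\<rat>. \<Union>b\<in>\<rat> \<inter> {a<..}. {x. \<exists>\<^sub>F t in at 0 within \<rat>. ?Q x t < a} \<inter>
        {x. \<exists>\<^sub>F t in at 0 within \<rat>. b < ?Q x t})"
    unfolding has_rational_derivative_def convergent_iff_no_oscillation[OF at_within_Rats_neq_bot]
    by (auto simp: frequently_def not_less)
  also have "\<dots> \<in> sets borel"
    by (intro sets.Un sets.countable_INT' sets.countable_UN' sets.Int image_subsetI
        sets_borel_frequently_rational S countable_Int1 countable_rat) simp_all
  finally show ?thesis .
qed

text \<open>The quotients are nonnegative, so divergence means that they are unbounded above or
  oscillate.\<close>

theorem monotone_has_rational_derivative_AE:
  fixes f :: "real \<Rightarrow> real"
  assumes f: "mono f"
  shows "{x. \<not> (\<exists>D. has_rational_derivative f 1 D x)} \<in> null_sets lborel"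
proof -
  let ?Q = "\<lambda>x t. (f (x + t) - f x) / t"
  have fb: "f \<in> borel_measurable borel" using f by (rule borel_measurable_mono)
  have "(\<lambda>x. f (x + t)) \<in> borel_measurable borel" for t
    by (rule measurable_compose[OF _ fb]) simp
  then have Q[measurable]: "(\<lambda>x. ?Q x t) \<in> borel_measurable borel" for t using fb by simp
  have "{x. c < ?Q x t} \<in> sets borel" "{x. ?Q x t < c} \<in> sets borel" for c t
    by measurable
  then have S: "{x. \<exists>\<^sub>F t in at 0 within \<rat>. c < ?Q x t} \<in> sets borel"
      "{x. \<exists>\<^sub>F t in at 0 within \<rat>. ?Q x t < c} \<in> sets borel" for c
    by (auto intro!: sets_borel_frequently_rational)
  define I where "I k = (\<Inter>n::nat. {x. \<exists>\<^sub>F t in at 0 within \<rat>. real n < ?Q x t}) \<inter> {- real k<..<real k}" for k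
  define Osc where "Osc k a b = {x. \<exists>\<^sub>F t in at 0 within \<rat>. ?Q x t < a} \<inter>
        {x. \<exists>\<^sub>F t in at 0 within \<rat>. b < ?Q x t} \<inter> {- real k<..<real k}" for k a b
  have I: "I k \<in> null_sets lborel" for k
  proof (rule null_setsI)
    have Ib: "I k \<in> sets borel" unfolding I_def using S by (intro sets.Int sets.countable_INT') auto
    show "emeasure lborel (I k) = 0"
      by (rule monotone_upper_quotients_infinite_null[OF f Ib, of k]) (auto simp: I_def)
    show "I k \<in> sets lborel" using Ib by simp
  qed
  have Osc: "Osc k a b \<in> null_sets lborel" if "a < b" for k a b
  proof (rule null_setsI)
    have Ob: "Osc k a b \<in> sets borel" unfolding Osc_def using S by (intro sets.Int) auto
    show "emeasure lborel (Osc k a b) = 0"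
      by (rule monotone_oscillating_quotients_null[OF f Ob _ that, of k]) (auto simp: Osc_def)
    show "Osc k a b \<in> sets lborel" using Ob by simp
  qed
  have pos: "?Q x t \<ge> 0" for x t
    using monoD[OF f, of x "x + t"] monoD[OF f, of "x + t" x]
    by (cases "t \<ge> 0") (auto simp: divide_nonneg_nonneg divide_nonpos_nonpos)
  have "{x. \<not> (\<exists>D. has_rational_derivative f 1 D x)} \<subseteq>
     (\<Union>k. I k) \<union> (\<Union>k. \<Union>a\<in>\<rat>. \<Union>b\<in>\<rat> \<inter> {a<..}. Osc k a b)"
  proof
    fix x assume "x \<in> {x. \<not> (\<exists>D. has_rational_derivative f 1 D x)}"
    then have "(\<forall>n::nat. \<exists>\<^sub>F t in at 0 within \<rat>. real n < ?Q x t) \<or>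
      (\<exists>a\<in>\<rat>. \<exists>b\<in>\<rat>. a < b \<and> (\<exists>\<^sub>F t in at 0 within \<rat>. ?Q x t < a) \<and> (\<exists>\<^sub>F t in at 0 within \<rat>. b < ?Q x t))"
      unfolding has_rational_derivative_def convergent_iff_no_oscillation[OF at_within_Rats_neq_bot]
      by (auto simp: frequently_def not_less abs_of_nonneg[OF pos] simp del: abs_divide)
    moreover obtain k :: nat where "\<bar>x\<bar> < real k" using reals_Archimedean2 by blast
    then have "x \<in> {- real k<..<real k}" by auto
    ultimately show "x \<in> (\<Union>k. I k) \<union> (\<Union>k. \<Union>a\<in>\<rat>. \<Union>b\<in>\<rat> \<inter> {a<..}. Osc k a b)"
      unfolding I_def Osc_def by blast
  qed
  moreover have "(\<Union>k. I k) \<union> (\<Union>k. \<Union>a\<in>\<rat>. \<Union>b\<in>\<rat> \<inter> {a<..}. Osc k a b) \<in> null_sets lborel"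
    using I Osc by (intro null_sets.Un null_sets_UN' null_sets_UN countable_rat countable_Int1) auto
  moreover have "{x. \<not> (\<exists>D. has_rational_derivative f 1 D x)} \<in> sets lborel"
    using sets_borel_no_rational_derivative[OF fb] by simp
  ultimately show ?thesis using null_sets_subset by blast
qed

section \<open>Quasiconvex functions on the line\<close>

lemma quasiconvex_max:
  assumes "quasiconvex f" "0 \<le> l" "l \<le> 1"
  shows "f (l *\<^sub>R x + (1 - l) *\<^sub>R y) \<le> max (f x) (f y)"
  using assms by (simp add: quasiconvex_def)

lemma quasiconvex_convex_sublevel:
  assumes "quasiconvex f"
  shows "convex {x. f x \<le> a}" "convex {x. f x < a}"
proof -
  have *: "f (u *\<^sub>R x + v *\<^sub>R y) \<le> max (f x) (f y)" if "u \<ge> 0" "v \<ge> 0" "u + v = 1" for u v x y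
  proof -
    have v: "v = 1 - u" using that by simp
    show ?thesis unfolding v by (rule quasiconvex_max[OF assms]) (use that in simp_all)
  qed
  show "convex {x. f x \<le> a}"
    by (rule convexI) (auto intro!: order_trans[OF *])
  show "convex {x. f x < a}"
    by (rule convexI) (auto intro!: le_less_trans[OF *])
qed

lemma quasiconvex_along_line:
  assumes "quasiconvex f"
  shows "quasiconvex (\<lambda>s::real. f (z + s *\<^sub>R w))"
  unfolding quasiconvex_def
proof (intro allI ballI)
  fix x y l :: real assume "l \<in> {0..1}"
  moreover have "z + (l *\<^sub>R x + (1 - l) *\<^sub>R y) *\<^sub>R w = l *\<^sub>R (z + x *\<^sub>R w) + (1 - l) *\<^sub>R (z + y *\<^sub>R w)"
    by (simp add: algebra_simps)
  ultimately show "f (z + (l *\<^sub>R x + (1 - l) *\<^sub>R y) *\<^sub>R w) \<le> max (f (z + x *\<^sub>R w)) (f (z + y *\<^sub>R w))"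
    using quasiconvex_max[OF assms, of l "z + x *\<^sub>R w" "z + y *\<^sub>R w"] by simp
qed

lemma has_rational_derivative_uminus:
  "has_rational_derivative (\<lambda>x. - f x) v (- D) x \<longleftrightarrow> has_rational_derivative f v D x"
proof -
  have "(\<lambda>t. (- f (x + t *\<^sub>R v) - - f x) / t) = (\<lambda>t. - ((f (x + t *\<^sub>R v) - f x) / t))"
    by (simp add: fun_eq_iff minus_divide_left)
  then show ?thesis
    unfolding has_rational_derivative_def by (simp only: tendsto_minus_cancel_left minus_minus)
qed

lemma has_rational_derivative_cong_interval:
  fixes f g :: "real \<Rightarrow> real"
  assumes "u < x" "x < v" "\<And>y. u \<le> y \<Longrightarrow> y \<le> v \<Longrightarrow> f y = g y"
  shows "has_rational_derivative f 1 D x \<longleftrightarrow> has_rational_derivative g 1 D x"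
  unfolding has_rational_derivative_def
proof (rule tendsto_cong)
  show "\<forall>\<^sub>F t in at 0 within \<rat>. (f (x + t *\<^sub>R 1) - f x) / t = (g (x + t *\<^sub>R 1) - g x) / t"
    unfolding eventually_at
    by (rule exI[of _ "min (x - u) (v - x)"]) (use assms in \<open>auto simp: dist_real_def\<close>)
qed

text \<open>A quasiconvex function on the line decreases up to some point and increases afterwards.
  Apart from that point, every point has a neighbourhood with rational endpoints on which \<open>f\<close>
  is monotone, and freezing \<open>f\<close> outside that neighbourhood gives a monotone function on the
  whole line.\<close>

theorem quasiconvex_has_rational_derivative_AE:
  fixes f :: "real \<Rightarrow> real"
  assumes qc: "quasiconvex f" and fb: "f \<in> borel_measurable borel"
  shows "{x. \<not> (\<exists>D. has_rational_derivative f 1 D x)} \<in> null_sets lborel"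
proof -
  \<comment> \<open>The points from which the function still descends form the decreasing part.\<close>
  define A where "A = {s. \<exists>t>s. f t < f s}"
  have A1: "f s \<le> f s'" if s: "s \<in> A" "s' < s" for s s'
  proof -
    obtain t where t: "t > s" "f t < f s" using s(1) unfolding A_def by blast
    define l where "l = (t - s) / (t - s')"
    have "l * (t - s') = t - s" using t s by (simp add: l_def)
    then have "l *\<^sub>R s' + (1 - l) *\<^sub>R t = s" by (simp add: algebra_simps)
    moreover have "0 \<le> l" "l \<le> 1" using t s by (auto simp: l_def field_simps)
    ultimately have "f s \<le> max (f s') (f t)" using quasiconvex_max[OF qc, of l s' t] by simp
    then show ?thesis using t by simp
  qed
  have A2: "s' \<in> A" if s: "s \<in> A" "s' < s" for s s'
  proof -
    obtain t where t: "t > s" "f t < f s" using s(1) unfolding A_def by blast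
    then have "s' < t" "f t < f s'" using A1[OF s] s by simp_all
    then show ?thesis by (auto simp: A_def)
  qed
  \<comment> \<open>The turning point, if there is one.\<close>
  define B where "B = {s. \<forall>u v. u < s \<longrightarrow> s < v \<longrightarrow> \<not> {u..v} \<subseteq> A \<and> \<not> {u..v} \<subseteq> - A}"
  have "\<not> s < s'" if "s \<in> B" "s' \<in> B" for s s'
  proof
    assume lt: "s < s'"
    define m where "m = (s + s') / 2"
    have m: "s < m" "m < s'" using lt by (simp_all add: m_def)
    show False
    proof (cases "m \<in> A")
      case True
      have "{s - 1..(s + m) / 2} \<subseteq> A"
      proof
        fix x assume "x \<in> {s - 1..(s + m) / 2}"
        then have "x \<le> (s + m) / 2" by simp
        then have "x < m" using m(1) by simp
        then show "x \<in> A" by (rule A2[OF True])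
      qed
      moreover have "s - 1 < s" "s < (s + m) / 2" using m by auto
      ultimately show False using that(1) unfolding B_def by blast
    next
      case False
      have "{(m + s') / 2..s' + 1} \<subseteq> - A"
      proof
        fix x assume "x \<in> {(m + s') / 2..s' + 1}"
        then have "(m + s') / 2 \<le> x" by simp
        then have "m < x" using m(2) by simp
        then show "x \<in> - A" using A2[of x m] False by blast
      qed
      moreover have "(m + s') / 2 < s'" "s' < s' + 1" using m by auto
      ultimately show False using that(2) unfolding B_def by blast
    qed
  qed
  then have B_single: "s = s'" if "s \<in> B" "s' \<in> B" for s s' using that by (meson linorder_neqE)
  have "countable B"
  proof (cases "B = {}")
    case False
    then obtain c where "c \<in> B" by blast
    then have "B = {c}" using B_single by blast
    then show ?thesis by simp
  qed simp
  then have B: "B \<in> null_sets lborel" by (rule countable_imp_null_set_lborel)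
  \<comment> \<open>The function frozen outside a window with endpoints u and v.\<close>
  define h where "h u v s = f (max u (min v s))" for u v s
  define N where "N u v = (if mono (h u v) \<or> mono (\<lambda>s. - h u v s)
      then {x. \<not> (\<exists>D. has_rational_derivative (h u v) 1 D x)} else {})" for u v
  have N: "N u v \<in> null_sets lborel" for u v
  proof -
    consider "mono (h u v)" | "mono (\<lambda>s. - h u v s)" | "N u v = {}" unfolding N_def by presburger
    then show ?thesis
    proof cases
      case 1
      then show ?thesis using monotone_has_rational_derivative_AE[OF 1] by (simp add: N_def)
    next
      case 2
      have "(\<exists>D. has_rational_derivative (h u v) 1 D x) \<longleftrightarrow>
          (\<exists>D. has_rational_derivative (\<lambda>s. - h u v s) 1 D x)" for x
        by (metis has_rational_derivative_uminus minus_minus)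
      then show ?thesis using monotone_has_rational_derivative_AE[OF 2] 2 by (simp add: N_def)
    qed simp
  qed
  have "{x. \<not> (\<exists>D. has_rational_derivative f 1 D x)} \<subseteq> B \<union> (\<Union>u\<in>\<rat>. \<Union>v\<in>\<rat>. N u v)"
  proof
    fix x assume x: "x \<in> {x. \<not> (\<exists>D. has_rational_derivative f 1 D x)}"
    show "x \<in> B \<union> (\<Union>u\<in>\<rat>. \<Union>v\<in>\<rat>. N u v)"
    proof (cases "x \<in> B")
      case False
      then obtain u0 v0 where 0: "u0 < x" "x < v0" "{u0..v0} \<subseteq> A \<or> {u0..v0} \<subseteq> - A"
        unfolding B_def by blast
      obtain u where u: "u \<in> \<rat>" "u0 < u" "u < x" using 0 Rats_dense_in_real by blast
      obtain v where v: "v \<in> \<rat>" "x < v" "v < v0" using 0 Rats_dense_in_real by blast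
      define k where "k s = max u (min v s)" for s
      have k: "k s \<in> {u0..v0}" for s using u v by (auto simp: k_def)
      have k_mono: "k s \<le> k t" if "s \<le> t" for s t using that by (auto simp: k_def)
      have h_k: "h u v s = f (k s)" for s by (simp add: h_def k_def)
      have "mono (h u v) \<or> mono (\<lambda>s. - h u v s)"
        using 0(3)
      proof
        assume sub: "{u0..v0} \<subseteq> A"
        have "f (k t) \<le> f (k s)" if "s \<le> t" for s t
          using A1[of "k t" "k s"] k[of t] sub k_mono[OF that] by (cases "k s = k t") auto
        then have "mono (\<lambda>s. - h u v s)" by (intro monoI) (simp add: h_k)
        then show ?thesis ..
      next
        assume sub: "{u0..v0} \<subseteq> - A"
        have "f (k s) \<le> f (k t)" if "s \<le> t" for s t
        proof (cases "k s = k t")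
          case False
          then have "k s < k t" using k_mono[OF that] by simp
          moreover have "k s \<notin> A" using k sub by blast
          ultimately show ?thesis unfolding A_def by (metis (mono_tags, lifting) mem_Collect_eq not_less)
        qed simp
        then have "mono (h u v)" by (intro monoI) (simp add: h_k)
        then show ?thesis ..
      qed
      moreover have "has_rational_derivative f 1 D x \<longleftrightarrow> has_rational_derivative (h u v) 1 D x" for D
        by (rule has_rational_derivative_cong_interval[OF u(3) v(2)]) (simp add: h_def)
      ultimately have "x \<in> N u v" using x by (simp add: N_def)
      then show ?thesis using u v by blast
    qed simp
  qed
  moreover have "B \<union> (\<Union>u\<in>\<rat>. \<Union>v\<in>\<rat>. N u v) \<in> null_sets lborel"
    using B N by (intro null_sets.Un null_sets_UN' countable_rat) auto
  moreover have "{x. \<not> (\<exists>D. has_rational_derivative f 1 D x)} \<in> sets lborel"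
    using sets_borel_no_rational_derivative[OF fb] by simp
  ultimately show ?thesis using null_sets_subset by blast
qed

section \<open>Quasiconvex homogeneous functions are additive\<close>

text \<open>A directional derivative of a quasiconvex function is quasiconvex, and it is odd because
  it is two-sided; being also homogeneous, it is additive. Writing \<open>v + w\<close> as the convex combination of
  \<open>v / l\<close> and \<open>w / (1 - l)\<close> bounds \<open>q (v + w)\<close> by the larger of \<open>q v / l\<close> and \<open>q w / (1 - l)\<close>. If both
  values have the same sign, the best \<open>l\<close> balances the two terms and gives \<open>q v + q w\<close>. Oddness
  yields the reverse inequality, and reduces the case of opposite signs to that of equal ones
  by moving a vector to the other side. A rational \<open>l\<close> near the best one gives the bound up to
  an arbitrarily small error.\<close>

lemma quasiconvex_homogeneous_imp_additive:
  fixes q :: "'a::real_vector \<Rightarrow> real"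
  assumes add: "\<And>v w. v \<in> V \<Longrightarrow> w \<in> V \<Longrightarrow> v + w \<in> V"
    and scale: "\<And>c v. c \<in> \<rat> \<Longrightarrow> v \<in> V \<Longrightarrow> c *\<^sub>R v \<in> V"
    and hom: "\<And>c v. c \<in> \<rat> \<Longrightarrow> v \<in> V \<Longrightarrow> q (c *\<^sub>R v) = c * q v"
    and qc: "\<And>l v w. l \<in> \<rat> \<Longrightarrow> 0 \<le> l \<Longrightarrow> l \<le> 1 \<Longrightarrow> v \<in> V \<Longrightarrow> w \<in> V \<Longrightarrow>
        q (l *\<^sub>R v + (1 - l) *\<^sub>R w) \<le> max (q v) (q w)"
    and "v \<in> V" "w \<in> V"
  shows "q (v + w) = q v + q w"
proof -
  have neg: "- v \<in> V" "q (- v) = - q v" if "v \<in> V" for v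
    using scale[of "-1" v] hom[of "-1" v] that by simp_all
  have split: "q (v + w) \<le> max (q v / l) (q w / (1 - l))"
    if "v \<in> V" "w \<in> V" "l \<in> \<rat>" "0 < l" "l < 1" for v w l
  proof -
    have l: "1 / l \<in> \<rat>" "1 / (1 - l) \<in> \<rat>" using that by auto
    have "l *\<^sub>R ((1 / l) *\<^sub>R v) + (1 - l) *\<^sub>R ((1 / (1 - l)) *\<^sub>R w) = v + w" using that by simp
    then have "q (v + w) \<le> max (q ((1 / l) *\<^sub>R v)) (q ((1 / (1 - l)) *\<^sub>R w))"
      using qc[of l "(1 / l) *\<^sub>R v" "(1 / (1 - l)) *\<^sub>R w"] that scale l by simp
    then show ?thesis using hom l that by simp
  qed
  have upper_nonneg: "q (v + w) \<le> q v + q w" if "v \<in> V" "w \<in> V" "q v \<ge> 0" "q w \<ge> 0" for v w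
  proof (rule dense_ge)
    fix s assume s: "q v + q w < s"
    then have "s > 0" using that by simp
    then have "q v / s < 1 - q w / s" using s by (simp add: field_simps)
    then obtain l where l: "l \<in> \<rat>" "q v / s < l" "l < 1 - q w / s" using Rats_dense_in_real by blast
    have "0 \<le> q v / s" "0 \<le> q w / s" using that \<open>s > 0\<close> by simp_all
    then have l01: "0 < l" "l < 1" using l by linarith+
    have "q v / l \<le> s" "q w / (1 - l) \<le> s" using l l01 \<open>s > 0\<close> by (auto simp: field_simps)
    then show "q (v + w) \<le> s" using split[OF that(1,2) l(1) l01] by simp
  qed
  have upper_neg: "q (v + w) \<le> q v + q w" if "v \<in> V" "w \<in> V" "q v < 0" "q w < 0" for v w
  proof (rule dense_ge_bounded)
    show "q v + q w < 0" using that by simp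
    fix s assume s: "q v + q w < s" "s < 0"
    have "1 < (q v + q w) / s" using s by (simp add: less_divide_eq)
    moreover have "0 < q v / s" "0 < q w / s" using s that by (simp_all add: divide_neg_neg)
    ultimately have "max 0 (1 - q w / s) < min 1 (q v / s)" by (simp add: add_divide_distrib)
    then obtain l where l: "l \<in> \<rat>" "max 0 (1 - q w / s) < l" "l < min 1 (q v / s)"
      using Rats_dense_in_real by blast
    then have l01: "0 < l" "l < 1" by auto
    have "q v / l \<le> s" "q w / (1 - l) \<le> s" using l l01 s by (auto simp: field_simps)
    then show "q (v + w) \<le> s" using split[OF that(1,2) l(1) l01] by simp
  qed
  have half: "1 / 2 \<in> (\<rat> :: real set)" by simp
  have nonneg: "q (v + w) \<ge> 0" if "v \<in> V" "w \<in> V" "q v \<ge> 0" "q w \<ge> 0" for v w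
  proof -
    have "q (- v + - w) \<le> 0" using split[of "- v" "- w" "1/2"] neg that half by auto
    moreover have "q (- v + - w) = - q (v + w)" using neg(2)[OF add[OF that(1,2)]] by simp
    ultimately show ?thesis by simp
  qed
  have eq0: "q (v + w) = q v + q w" if "v \<in> V" "w \<in> V" "q v = 0" "q w \<ge> 0" for v w
  proof (rule antisym)
    show "q (v + w) \<le> q v + q w" using upper_nonneg[OF that(1,2)] that by simp
    have "q ((v + w) + - v) \<le> q (v + w) + q (- v)"
      using that neg add nonneg by (intro upper_nonneg) auto
    then show "q v + q w \<le> q (v + w)" using that neg by simp
  qed
  have eq_nonneg: "q (v + w) = q v + q w" if vw: "v \<in> V" "w \<in> V" "q v \<ge> 0" "q w \<ge> 0" for v w
  proof -
    consider "q v = 0" | "q w = 0" | "q v > 0" "q w > 0" using vw by linarith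
    then show ?thesis
    proof cases
      case 1 then show ?thesis using eq0 that by simp
    next
      case 2 then show ?thesis using eq0[of w v] that by (simp add: add.commute)
    next
      case 3
      have "q (- v + - w) \<le> q (- v) + q (- w)" using 3 that neg by (intro upper_neg) auto
      moreover have "q (- v + - w) = - q (v + w)" using neg(2)[OF add[OF that(1,2)]] by simp
      ultimately show ?thesis using upper_nonneg[OF that] neg that by simp
    qed
  qed
  have eq_mixed: "q (v + w) = q v + q w" if "v \<in> V" "w \<in> V" "q v \<ge> 0" "q w \<le> 0" for v w
  proof (cases "q (v + w) \<ge> 0")
    case True
    have "q ((v + w) + - w) = q (v + w) + q (- w)"
      using True that neg add by (intro eq_nonneg) auto
    then show ?thesis using neg that by simp
  next
    case False
    have "q (v + - (v + w)) = q v + q (- (v + w))"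
      using False that neg(1)[OF add[OF that(1,2)]] neg(2)[OF add[OF that(1,2)]]
      by (intro eq_nonneg) simp_all
    then show ?thesis using neg(2)[OF add[OF that(1,2)]] neg(2)[OF that(2)] by simp
  qed
  show ?thesis
  proof (cases "q v \<ge> 0")
    case True
    then show ?thesis using eq_nonneg eq_mixed assms(5,6) by (cases "q w \<ge> 0") auto
  next
    case False
    have "q (- v + - w) = q (- v) + q (- w)"
      using False eq_nonneg[of "- v" "- w"] eq_mixed[of "- v" "- w"] assms(5,6) neg
      by (cases "q w \<ge> 0") auto
    moreover have "q (- v + - w) = - q (v + w)" using neg(2)[OF add[OF assms(5,6)]] by simp
    ultimately show ?thesis using neg assms(5,6) by simp
  qed
qed

section \<open>The lower semicontinuous hull of a quasiconvex function\<close>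

text \<open>The lower semicontinuous hull, written through closures of sublevel sets because these
  stay convex and invariant when the sublevel sets are. A quasiconvex function need not be
  Borel, since the boundary points of its sublevel sets are arbitrary; its hull is.\<close>

definition lsc_hull :: "('a::topological_space \<Rightarrow> real) \<Rightarrow> 'a \<Rightarrow> real" where
  "lsc_hull f x = Inf {a. x \<in> closure {y. f y < a}}"

locale bounded_below_function =
  fixes f :: "'a::real_normed_vector \<Rightarrow> real" and m :: real
  assumes bounded_below: "m \<le> f x"
begin

lemma lsc_hull_bdd: "bdd_below {a. x \<in> closure {y. f y < a}}"
proof -
  have "m \<le> a" if "x \<in> closure {y. f y < a}" for a
  proof (rule ccontr)
    assume "\<not> m \<le> a"
    then have "\<not> f y < a" for y using bounded_below[of y] by simp
    then have "{y. f y < a} = {}" by simp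
    then show False using that by simp
  qed
  then show ?thesis by (auto simp: bdd_below_def)
qed

lemma lsc_hull_le: "x \<in> closure {y. f y < a} \<Longrightarrow> lsc_hull f x \<le> a"
  unfolding lsc_hull_def by (intro cInf_lower lsc_hull_bdd) simp

lemma lsc_hull_lessD:
  assumes "lsc_hull f x < a" shows "x \<in> closure {y. f y < a}"
proof -
  have "x \<in> closure {y. f y < f x + 1}" using closure_subset[of "{y. f y < f x + 1}"] by auto
  then have ne: "{a. x \<in> closure {y. f y < a}} \<noteq> {}" by blast
  obtain b where "x \<in> closure {y. f y < b}" "b < a"
    using cInf_lessD[OF ne] assms unfolding lsc_hull_def by blast
  moreover have "closure {y. f y < b} \<subseteq> closure {y. f y < a}"
    by (rule closure_mono) (use \<open>b < a\<close> in auto)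
  ultimately show ?thesis by blast
qed

lemma lsc_hull_sublevel: "{x. lsc_hull f x \<le> a} = (\<Inter>b\<in>{a<..}. closure {y. f y < b})"
proof (intro equalityI subsetI)
  fix x assume "x \<in> (\<Inter>b\<in>{a<..}. closure {y. f y < b})"
  then have "lsc_hull f x \<le> b" if "a < b" for b using that lsc_hull_le by blast
  then show "x \<in> {x. lsc_hull f x \<le> a}" using dense_ge by blast
qed (use lsc_hull_lessD le_less_trans in blast)

lemma closed_lsc_hull_sublevel: "closed {x. lsc_hull f x \<le> a}"
  unfolding lsc_hull_sublevel by auto

lemma open_lsc_hull_superlevel: "open {x. a < lsc_hull f x}"
proof -
  have "- {x. lsc_hull f x \<le> a} = {x. a < lsc_hull f x}" by auto
  then show ?thesis using closed_lsc_hull_sublevel[of a] by (metis open_Compl)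
qed

lemma borel_lsc_hull: "lsc_hull f \<in> borel_measurable borel"
  unfolding borel_measurable_iff_le using closed_lsc_hull_sublevel by simp

lemma lsc_hull_le_self: "lsc_hull f x \<le> f x"
proof (rule dense_ge)
  fix a assume "f x < a"
  then show "lsc_hull f x \<le> a" using closure_subset[of "{y. f y < a}"] by (intro lsc_hull_le) auto
qed

lemma quasiconvex_lsc_hull:
  assumes "quasiconvex f"
  shows "quasiconvex (lsc_hull f)"
  unfolding quasiconvex_def
proof (intro allI ballI)
  fix x y l assume l: "l \<in> {0..1::real}"
  let ?a = "max (lsc_hull f x) (lsc_hull f y)"
  have "convex {x. lsc_hull f x \<le> ?a}"
    unfolding lsc_hull_sublevel
    by (intro convex_INT convex_closure quasiconvex_convex_sublevel(2) assms)
  then have "l *\<^sub>R x + (1 - l) *\<^sub>R y \<in> {x. lsc_hull f x \<le> ?a}"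
    using l by (intro convexD) auto
  then show "lsc_hull f (l *\<^sub>R x + (1 - l) *\<^sub>R y) \<le> ?a" by simp
qed

lemma lsc_hull_invariant:
  assumes "continuous_on UNIV T" "\<And>x. f (T x) = f x"
  shows "lsc_hull f (T x) \<le> lsc_hull f x"
proof (rule dense_ge)
  fix a assume "lsc_hull f x < a"
  then have x: "x \<in> closure {y. f y < a}" by (rule lsc_hull_lessD)
  have "T ` closure {y. f y < a} \<subseteq> closure {y. f y < a}"
  proof (rule image_closure_subset)
    show "continuous_on (closure {y. f y < a}) T" using assms(1) continuous_on_subset by blast
    show "T ` {y. f y < a} \<subseteq> closure {y. f y < a}"
      using closure_subset[of "{y. f y < a}"] assms(2) by auto
  qed simp
  then show "lsc_hull f (T x) \<le> a" using x lsc_hull_le by blast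
qed

text \<open>A convex set that contains a ball around \<open>w\<close> also contains the points strictly between \<open>w\<close>
  and any point of its closure. This is how values of the hull control values of the
  function.\<close>

lemma quasiconvex_le_max_lsc_hull:
  assumes qc: "quasiconvex f" and r: "r > 0" "\<And>w'. dist w' w < r \<Longrightarrow> f w' \<le> a"
    and l: "0 \<le> l" "l < 1"
  shows "f (l *\<^sub>R z + (1 - l) *\<^sub>R w) \<le> max (lsc_hull f z) a"
proof (rule dense_ge)
  fix b assume b: "max (lsc_hull f z) a < b"
  let ?e = "(1 - l) * r"
  have "?e > 0" using r l by simp
  moreover have "z \<in> closure {y. f y < b}" using b by (intro lsc_hull_lessD) simp
  ultimately obtain z' where z': "f z' < b" "dist z' z < ?e"
    unfolding closure_approachable by blast
  \<comment> \<open>Replacing z by a nearby point of the sublevel set is compensated by moving w inside the ball.\<close>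
  define w' where "w' = w + (l / (1 - l)) *\<^sub>R (z - z')"
  have "dist w' w = l / (1 - l) * dist z' z"
    using l by (simp add: w'_def dist_norm norm_minus_commute)
  also have "\<dots> \<le> 1 / (1 - l) * dist z' z" using l by (intro mult_right_mono divide_right_mono) auto
  also have "\<dots> < r" using z' l by (simp add: field_simps)
  finally have "f w' < b" using r(2)[of w'] b by simp
  have "(1 - l) *\<^sub>R w' = (1 - l) *\<^sub>R w + l *\<^sub>R (z - z')"
    using l by (simp add: w'_def scaleR_add_right)
  then have "l *\<^sub>R z + (1 - l) *\<^sub>R w = l *\<^sub>R z' + (1 - l) *\<^sub>R w'"
    by (simp add: algebra_simps)
  then have "f (l *\<^sub>R z + (1 - l) *\<^sub>R w) \<le> max (f z') (f w')"
    using quasiconvex_max[OF qc, of l z' w'] l by simp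
  then show "f (l *\<^sub>R z + (1 - l) *\<^sub>R w) \<le> b" using z' \<open>f w' < b\<close> by simp
qed

end

section \<open>Convex sets invariant under a periodic map\<close>

text \<open>The sum over an orbit is a fixed point, hence zero. Averaging over an orbit therefore moves
  any point of an invariant convex set to the origin, and perturbing one term of the average
  moves around the origin.\<close>

locale periodic_map_without_fixed_point =
  fixes T :: "'a::real_normed_vector \<Rightarrow> 'a" and p :: nat
  assumes bounded_linear: "bounded_linear T"
    and period: "p > 1" "T ^^ p = id"
    and fixed_point: "T x = x \<Longrightarrow> x = 0"
begin

lemma orbit_sum_eq_0: "(\<Sum>k<p. (T ^^ k) x) = 0"
proof (rule fixed_point)
  have "T (\<Sum>k<p. (T ^^ k) x) = (\<Sum>k<p. (T ^^ Suc k) x)"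
    by (simp add: linear_sum[OF bounded_linear.linear[OF bounded_linear]])
  also have "\<dots> + (T ^^ 0) x = (\<Sum>k<Suc p. (T ^^ k) x)"
    by (subst sum.lessThan_Suc_shift) simp
  also have "\<dots> = (\<Sum>k<p. (T ^^ k) x) + (T ^^ 0) x" using period by simp
  finally show "T (\<Sum>k<p. (T ^^ k) x) = (\<Sum>k<p. (T ^^ k) x)" by simp
qed

lemma funpow_in_invariant: "T ` C \<subseteq> C \<Longrightarrow> x \<in> C \<Longrightarrow> (T ^^ k) x \<in> C"
  by (induction k) auto

text \<open>The average of \<open>y, T x, T\<^sup>2 x, \<dots>\<close>, which differs from the orbit average of \<open>x\<close> in the first
  term only.\<close>

lemma orbit_average_perturbed:
  assumes "convex C" "T ` C \<subseteq> C" "x \<in> C" "y \<in> C"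
  shows "(1 / real p) *\<^sub>R (y - x) \<in> C"
proof -
  define u where "u k = (if k = 0 then y else (T ^^ k) x)" for k
  have "(\<Sum>k<p. (1 / real p) *\<^sub>R u k) \<in> C"
    by (rule convex_sum) (use assms period funpow_in_invariant in \<open>auto simp: u_def\<close>)
  also have "(\<Sum>k<p. (1 / real p) *\<^sub>R u k) = (1 / real p) *\<^sub>R (\<Sum>k<p. u k)"
    by (simp add: scaleR_sum_right)
  also have "(\<Sum>k<p. u k) = (\<Sum>k<p. (T ^^ k) x + (if k = 0 then y - x else 0))"
    by (rule sum.cong) (auto simp: u_def)
  also have "\<dots> = y - x"
    using period by (simp add: sum.distrib orbit_sum_eq_0)
  finally show ?thesis .
qed

lemma zero_in_convex_invariant:
  assumes "convex C" "T ` C \<subseteq> C" "x \<in> C"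
  shows "0 \<in> C"
  using orbit_average_perturbed[OF assms assms(3)] by simp

lemma neg_in_convex_invariant:
  assumes "convex C" "T ` C \<subseteq> C" "x \<in> C"
  shows "(- 1 / real p) *\<^sub>R x \<in> C"
  using orbit_average_perturbed[OF assms zero_in_convex_invariant[OF assms]] by simp

lemma ball_in_convex_invariant:
  assumes "convex C" "T ` C \<subseteq> C" "interior C \<noteq> {}"
  obtains r where "r > 0" "ball 0 r \<subseteq> C"
proof -
  obtain x e where x: "e > 0" "ball x e \<subseteq> C" using assms(3) by (auto simp: mem_interior)
  then have xC: "x \<in> C" by auto
  show thesis
  proof (rule that[of "e / real p"])
    show "0 < e / real p" using x period by simp
    show "ball 0 (e / real p) \<subseteq> C"
    proof
      fix z :: 'a assume "z \<in> ball 0 (e / real p)"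
      then have "norm (real p *\<^sub>R z) < e" using period by (simp add: field_simps)
      then have "x + real p *\<^sub>R z \<in> C" using x(2) by (auto simp: subset_iff dist_norm)
      from orbit_average_perturbed[OF assms(1,2) xC this] show "z \<in> C" using period by simp
    qed
  qed
qed

end

section \<open>Haar null sets\<close>

text \<open>Considering all parallel lines makes the notion invariant under translations, as Haar null
  sets are.\<close>

definition null_along :: "'a::real_normed_vector \<Rightarrow> 'a set \<Rightarrow> bool" where
  "null_along w A \<longleftrightarrow> A \<in> sets borel \<and> (\<forall>z. {s. z + s *\<^sub>R w \<in> A} \<in> null_sets lborel)"

lemma borel_translation:
  fixes A :: "'a::real_normed_vector set"
  assumes "A \<in> sets borel"
  shows "(+) z ` A \<in> sets borel"
proof -
  have "(\<lambda>y. y - z) \<in> borel_measurable borel"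
    by (intro borel_measurable_continuous_onI continuous_intros)
  from measurable_sets[OF this assms] have "(\<lambda>y. y - z) -` A \<in> sets borel" by simp
  also have "(\<lambda>y. y - z) -` A = (+) z ` A" by (force simp: image_iff)
  finally show ?thesis .
qed

text \<open>The measure is the law of a random series \<open>\<Sum>\<xi>\<^sub>n w\<^sub>n\<close> with independent \<open>\<xi>\<^sub>n\<close>, uniformly
  distributed on intervals short enough for absolute convergence. Conditioned on all other
  coefficients, the sum is uniformly distributed on a segment of direction \<open>w\<^sub>n\<close>, so Fubini's
  theorem applies to each \<open>n\<close> separately. A single measure thus serves all directions of the
  sequence, which makes countable unions harmless.\<close>

theorem exists_measure_vanishing_on_null_along:
  fixes w :: "nat \<Rightarrow> 'a::banach"
  obtains \<mu> where "prob_space \<mu>" "sets \<mu> = sets borel"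
    "\<And>n A z. null_along (w n) A \<Longrightarrow> emeasure \<mu> ((+) z ` A) = 0"
proof -
  define a where "a n = (1/2) ^ n / (1 + norm (w n))" for n
  have a_pos: "a n > 0" for n
    unfolding a_def by (intro divide_pos_pos) (auto intro: add_pos_nonneg)
  have a_bound: "a n * norm (w n) \<le> (1/2) ^ n" for n
  proof -
    have "norm (w n) / (1 + norm (w n)) \<le> 1"
      using norm_ge_zero[of "w n"] by (subst divide_le_eq_1_pos) linarith+
    then have "(1/2) ^ n * (norm (w n) / (1 + norm (w n))) \<le> (1/2::real) ^ n * 1"
      by (intro mult_left_mono) auto
    then show ?thesis by (simp add: a_def)
  qed
  \<comment> \<open>Clamping the coefficients makes the series uniformly convergent, and its sum continuous, on the whole product space.\<close>
  define c where "c n s = max 0 (min (a n) s)" for n s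
  have c: "0 \<le> c n s" "c n s \<le> a n" for n s using a_pos[of n] by (auto simp: c_def)
  define \<Phi> where "\<Phi> = (\<lambda>\<xi>. \<Sum>n. c n (\<xi> n) *\<^sub>R w n)"
  have bound: "norm (c n (\<xi> n) *\<^sub>R w n) \<le> (1/2) ^ n" for n and \<xi> :: "nat \<Rightarrow> real"
  proof -
    have "norm (c n (\<xi> n) *\<^sub>R w n) \<le> a n * norm (w n)"
      using c[of n "\<xi> n"] by (simp add: mult_right_mono)
    then show ?thesis using a_bound order_trans by blast
  qed
  have summable_half: "summable (\<lambda>n. (1/2::real) ^ n)" by (rule summable_geometric) simp
  have sm: "summable (\<lambda>n. c n (\<xi> n) *\<^sub>R w n)" for \<xi> :: "nat \<Rightarrow> real"
    by (rule summable_comparison_test[OF _ summable_half]) (use bound in auto)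
  have "continuous_on UNIV \<Phi>"
  proof (rule uniform_limit_theorem)
    show "uniform_limit UNIV (\<lambda>n \<xi>. \<Sum>i<n. c i (\<xi> i) *\<^sub>R w i) \<Phi> sequentially"
      unfolding \<Phi>_def by (rule Weierstrass_m_test[OF bound summable_half])
    show "\<forall>\<^sub>F n in sequentially. continuous_on UNIV (\<lambda>\<xi>. \<Sum>i<n. c i (\<xi> i) *\<^sub>R w i)"
      unfolding c_def
      by (intro always_eventually allI continuous_intros continuous_on_product_coordinates)
  qed simp
  define M where "M n = uniform_measure lborel {0..a n}" for n
  have M: "prob_space (M n)" "sets (M n) = sets borel" "space (M n) = UNIV" for n
    using a_pos[of n] unfolding M_def by (auto intro!: prob_space_uniform_measure)
  define P where "P = PiM UNIV M"
  have "sets P = sets (PiM UNIV (\<lambda>_::nat. borel :: real measure))"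
    unfolding P_def by (rule sets_PiM_cong) (auto simp: M)
  then have sets_P: "sets P = sets borel" by (simp add: sets_PiM_equal_borel)
  then have space_P: "space P = UNIV" by (metis sets_eq_imp_space_eq space_borel)
  interpret P: prob_space P unfolding P_def by (rule prob_space_PiM) (rule M)
  have "\<Phi> \<in> borel_measurable borel"
    using \<open>continuous_on UNIV \<Phi>\<close> by (rule borel_measurable_continuous_onI)
  then have \<Phi>[measurable]: "\<Phi> \<in> borel_measurable P" using sets_P by (simp cong: measurable_cong_sets)
  show thesis
  proof (rule that[of "distr P borel \<Phi>"])
    show "prob_space (distr P borel \<Phi>)" by (rule P.prob_space_distr) (rule \<Phi>)
    show "sets (distr P borel \<Phi>) = sets borel" by simp
    fix n A z assume A: "null_along (w n) A"
    let ?B = "(+) z ` A"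
    have B: "?B \<in> sets borel" using A by (intro borel_translation) (simp add: null_along_def)
    let ?S = "\<Phi> -` ?B"
    have S: "?S \<in> sets P" using measurable_sets[OF \<Phi> B] by (simp add: space_P)
    have P_eq: "P = distr (M n \<Otimes>\<^sub>M P) P (\<lambda>(x, X). X(n := x))"
      using distr_pair_PiM_eq_PiM[of UNIV M n] M by (simp add: P_def)
    have upd: "(\<lambda>(x, X). X(n := x)) \<in> M n \<Otimes>\<^sub>M P \<rightarrow>\<^sub>M P"
      unfolding P_def case_prod_unfold
      by (rule measurable_fun_upd[where J = UNIV]) measurable
    interpret Mn: prob_space "M n" by (rule M)
    interpret pair_sigma_finite "M n" P ..
    have "emeasure (distr P borel \<Phi>) ?B = emeasure P ?S"
      using B by (simp add: emeasure_distr space_P)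
    also have "\<dots> = emeasure (distr (M n \<Otimes>\<^sub>M P) P (\<lambda>(x, X). X(n := x))) ?S"
      using P_eq by simp
    also have "\<dots> = emeasure (M n \<Otimes>\<^sub>M P) ((\<lambda>(x, X). X(n := x)) -` ?S \<inter> space (M n \<Otimes>\<^sub>M P))"
      using S by (rule emeasure_distr[OF upd])
    also have "\<dots> = (\<integral>\<^sup>+ X. emeasure (M n) ((\<lambda>x. (x, X)) -`
        ((\<lambda>(x, X). X(n := x)) -` ?S \<inter> space (M n \<Otimes>\<^sub>M P))) \<partial>P)"
      by (rule emeasure_pair_measure_alt2) (rule measurable_sets[OF upd S])
    also have "\<dots> = (\<integral>\<^sup>+ X. 0 \<partial>P)"
    proof (rule nn_integral_cong)
      fix X assume "X \<in> space P"
      let ?C = "(\<lambda>x. (x, X)) -` ((\<lambda>(x, X). X(n := x)) -` ?S \<inter> space (M n \<Otimes>\<^sub>M P))"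
      have C: "?C = {x. \<Phi> (X(n := x)) \<in> ?B}"
        by (auto simp: space_pair_measure space_P M)
      have "?C \<in> sets (M n)"
        by (rule sets_Pair2) (rule measurable_sets[OF upd S])
      then have Cb: "?C \<in> sets lborel" using M by simp
      define y where "y = \<Phi> (X(n := 0)) - z"
      \<comment> \<open>Changing the n-th coefficient moves the sum along the n-th direction.\<close>
      have \<Phi>_upd: "\<Phi> (X(n := x)) = \<Phi> (X(n := 0)) + x *\<^sub>R w n" if "x \<in> {0..a n}" for x
      proof -
        have "\<Phi> (X(n := x)) - \<Phi> (X(n := 0)) =
            (\<Sum>i. c i ((X(n := x)) i) *\<^sub>R w i - c i ((X(n := 0)) i) *\<^sub>R w i)"
          unfolding \<Phi>_def by (rule suminf_diff[OF sm sm])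
        also have "\<dots> = (\<Sum>i\<in>{n}. c i ((X(n := x)) i) *\<^sub>R w i - c i ((X(n := 0)) i) *\<^sub>R w i)"
          by (rule suminf_finite) auto
        also have "\<dots> = x *\<^sub>R w n" using that a_pos[of n] by (simp add: c_def)
        finally show ?thesis by (simp add: algebra_simps)
      qed
      have "{0..a n} \<inter> ?C \<subseteq> {s. y + s *\<^sub>R w n \<in> A}"
      proof
        fix x assume "x \<in> {0..a n} \<inter> ?C"
        then have x: "x \<in> {0..a n}" "\<Phi> (X(n := x)) \<in> ?B" unfolding C by simp_all
        then obtain u where u: "u \<in> A" "\<Phi> (X(n := x)) = z + u" by blast
        then have "u = y + x *\<^sub>R w n" using \<Phi>_upd[OF x(1)] by (simp add: y_def algebra_simps)
        then show "x \<in> {s. y + s *\<^sub>R w n \<in> A}" using u(1) by simp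
      qed
      moreover have "{s. y + s *\<^sub>R w n \<in> A} \<in> null_sets lborel" using A by (simp add: null_along_def)
      ultimately have "{0..a n} \<inter> ?C \<in> null_sets lborel"
        using Cb null_sets_subset[of "{s. y + s *\<^sub>R w n \<in> A}" lborel "{0..a n} \<inter> ?C"] by simp
      then show "emeasure (M n) ?C = 0"
        using Cb unfolding M_def by (simp add: null_sets_def)
    qed
    finally show "emeasure (distr P borel \<Phi>) ?B = 0" by simp
  qed
qed

corollary haar_null_UN_null_along:
  fixes w :: "nat \<Rightarrow> 'a::banach"
  assumes "\<And>n. null_along (w n) (A n)"
  shows "haar_null (\<Union>n. A n)"
proof -
  obtain \<mu> where \<mu>: "prob_space \<mu>" "sets \<mu> = sets borel"
    "\<And>n A z. null_along (w n) A \<Longrightarrow> emeasure \<mu> ((+) z ` A) = 0"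
    using exists_measure_vanishing_on_null_along[of w] by blast
  have b: "A n \<in> sets borel" for n using assms by (simp add: null_along_def)
  have "emeasure \<mu> ((+) z ` (\<Union>n. A n)) = 0" for z
  proof -
    have "(+) z ` A n \<in> null_sets \<mu>" for n
      using \<mu>(2) \<mu>(3)[OF assms] borel_translation[OF b] by (intro null_setsI) auto
    then have "(\<Union>n. (+) z ` A n) \<in> null_sets \<mu>" by (rule null_sets_UN)
    then show ?thesis by (simp add: image_UN null_sets_def)
  qed
  then show ?thesis unfolding haar_null_def using \<mu> b by blast
qed

text \<open>Otherwise the set would contain a ball, countably many translates of which cover the space.\<close>

lemma haar_null_complement_dense:
  fixes N :: "'a::real_normed_vector set"
  assumes sep: "separable_space (euclidean :: 'a topology)" and N: "haar_null N"
  shows "closure (- N) = UNIV"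
proof (rule ccontr)
  assume "closure (- N) \<noteq> UNIV"
  then obtain x where "x \<in> - closure (- N)" by blast
  then have "x \<in> interior N" by (simp add: interior_closure)
  then obtain r where r: "r > 0" "ball x r \<subseteq> N" by (auto simp: mem_interior)
  obtain C :: "'a set" where C: "countable C" "closure C = UNIV"
    using sep unfolding separable_space_def by auto
  obtain \<mu> where \<mu>: "prob_space \<mu>" "sets \<mu> = sets borel" "\<And>z. emeasure \<mu> ((+) z ` N) = 0"
    and Nb: "N \<in> sets borel"
    using N unfolding haar_null_def by blast
  interpret prob_space \<mu> by (rule \<mu>(1))
  have "(+) (d - x) ` N \<in> null_sets \<mu>" for d
    using \<mu>(2,3) borel_translation[OF Nb] by (intro null_setsI) auto
  then have null: "(\<Union>d\<in>C. (+) (d - x) ` N) \<in> null_sets \<mu>"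
    using C(1) by (intro null_sets_UN') auto
  have "(\<Union>d\<in>C. (+) (d - x) ` N) = UNIV"
  proof (intro equalityI subsetI UNIV_I)
    fix y
    have "y \<in> closure C" using C by simp
    then obtain d where d: "d \<in> C" "dist d y < r" using r(1) by (auto simp: closure_approachable)
    then have "y - (d - x) \<in> ball x r" by (simp add: dist_norm algebra_simps)
    then have "y - (d - x) \<in> N" using r(2) by blast
    then have "y \<in> (+) (d - x) ` N" by (auto intro!: image_eqI[of _ _ "y - (d - x)"])
    then show "y \<in> (\<Union>d\<in>C. (+) (d - x) ` N)" using d(1) by blast
  qed
  moreover have "space \<mu> = UNIV" using \<mu>(2) by (metis sets_eq_imp_space_eq space_borel)
  ultimately show False using null emeasure_space_1 by (simp add: null_sets_def)
qed

section \<open>Gateaux derivatives from countably many directions\<close>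

lemma has_rational_derivative_unique:
  "has_rational_derivative f v D x \<Longrightarrow> has_rational_derivative f v D' x \<Longrightarrow> D = D'"
  unfolding has_rational_derivative_def
  using tendsto_unique[OF at_within_Rats_neq_bot] by blast

lemma has_rational_derivative_scaleR:
  assumes "has_rational_derivative f v D x" "c \<in> \<rat>"
  shows "has_rational_derivative f (c *\<^sub>R v) (c * D) x"
proof (cases "c = 0")
  case True
  then show ?thesis by (simp add: has_rational_derivative_def)
next
  case False
  let ?Q = "\<lambda>t. (f (x + t *\<^sub>R v) - f x) / t"
  have "((\<lambda>t. c * t) \<longlongrightarrow> 0) (at (0::real) within \<rat>)"
    by (auto intro!: tendsto_eq_intros)
  moreover have "\<forall>\<^sub>F t in at 0 within \<rat>. c * t \<in> \<rat> \<and> c * t \<noteq> 0"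
    using assms(2) False by (auto simp: eventually_at intro!: exI[of _ 1])
  ultimately have "filterlim (\<lambda>t. c * t) (at 0 within \<rat>) (at 0 within \<rat>)"
    by (simp add: filterlim_at)
  from filterlim_compose[OF assms(1)[unfolded has_rational_derivative_def] this]
  have "((\<lambda>t. c * ?Q (c * t)) \<longlongrightarrow> c * D) (at 0 within \<rat>)"
    by (rule tendsto_mult_left)
  moreover have "c * ?Q (c * t) = (f (x + t *\<^sub>R (c *\<^sub>R v)) - f x) / t" for t
    using False by (simp add: mult.commute)
  ultimately show ?thesis by (simp add: has_rational_derivative_def)
qed

lemma has_rational_derivative_imp_tendsto:
  assumes "has_rational_derivative f v D x"
  shows "((\<lambda>t. f (x + t *\<^sub>R v)) \<longlongrightarrow> f x) (at 0 within \<rat>)"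
proof -
  have "((\<lambda>t. f x + t * ((f (x + t *\<^sub>R v) - f x) / t)) \<longlongrightarrow> f x + 0 * D) (at 0 within \<rat>)"
    using assms unfolding has_rational_derivative_def by (intro tendsto_intros)
  then have "((\<lambda>t. f x + t * ((f (x + t *\<^sub>R v) - f x) / t)) \<longlongrightarrow> f x) (at 0 within \<rat>)"
    by simp
  then show ?thesis
    by (rule Lim_transform_eventually) (auto simp: eventually_at intro!: exI[of _ 1])
qed

lemma at_within_positive_Rats_neq_bot: "at (0::real) within (\<rat> \<inter> {0<..}) \<noteq> bot"
proof -
  have "(0::real) islimpt (\<rat> \<inter> {0<..})"
    unfolding islimpt_approachable
  proof (intro allI impI)
    fix e :: real assume "e > 0"
    then obtain q where q: "q \<in> \<rat>" "0 < q" "q < e" using Rats_dense_in_real by blast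
    then have "q \<in> \<rat> \<inter> {0<..}" "q \<noteq> 0 \<and> dist q 0 < e" by simp_all
    then show "\<exists>x'::real\<in>\<rat> \<inter> {0<..}. x' \<noteq> 0 \<and> dist x' 0 < e" by blast
  qed
  then show ?thesis by (simp add: trivial_limit_within)
qed

text \<open>Real increments are replaced by slightly larger rational ones. The relative error vanishes
  in the limit, so the replacement does not affect difference quotients.\<close>

lemma rational_approximation_from_above:
  obtains \<tau> :: "real \<Rightarrow> real"
  where "\<And>t. t > 0 \<Longrightarrow> \<tau> t \<in> \<rat> \<and> t < \<tau> t \<and> \<tau> t < t + t\<^sup>2"
    "filterlim \<tau> (at 0 within \<rat>) (at_right 0)" "((\<lambda>t. \<tau> t / t) \<longlongrightarrow> 1) (at_right 0)"
proof -
  have "\<forall>t::real. \<exists>u. t > 0 \<longrightarrow> u \<in> \<rat> \<and> t < u \<and> u < t + t\<^sup>2"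
  proof
    fix t :: real
    show "\<exists>u. t > 0 \<longrightarrow> u \<in> \<rat> \<and> t < u \<and> u < t + t\<^sup>2"
    proof (cases "t > 0")
      case True
      then have "t < t + t\<^sup>2" by simp
      then show ?thesis using Rats_dense_in_real by blast
    qed simp
  qed
  then obtain \<tau> :: "real \<Rightarrow> real" where \<tau>: "\<And>t. t > 0 \<Longrightarrow> \<tau> t \<in> \<rat> \<and> t < \<tau> t \<and> \<tau> t < t + t\<^sup>2" by metis
  have pos: "\<forall>\<^sub>F t in at_right (0::real). 0 < t" by (simp add: eventually_at_right_less)
  have "(\<tau> \<longlongrightarrow> 0) (at_right 0)"
  proof (rule tendsto_sandwich)
    show "\<forall>\<^sub>F t in at_right 0. t \<le> \<tau> t" "\<forall>\<^sub>F t in at_right 0. \<tau> t \<le> t + t\<^sup>2"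
      using pos by (eventually_elim; use \<tau> less_imp_le in blast)+
    show "((\<lambda>t. t) \<longlongrightarrow> (0::real)) (at_right 0)" "((\<lambda>t. t + t\<^sup>2) \<longlongrightarrow> (0::real)) (at_right 0)"
      by (auto intro!: tendsto_eq_intros)
  qed
  moreover have "\<forall>\<^sub>F t in at_right 0. \<tau> t \<in> \<rat> \<and> \<tau> t \<noteq> 0"
    using pos by eventually_elim (use \<tau> in force)
  ultimately have "filterlim \<tau> (at 0 within \<rat>) (at_right 0)" by (simp add: filterlim_at)
  moreover have "((\<lambda>t. \<tau> t / t) \<longlongrightarrow> 1) (at_right 0)"
  proof (rule tendsto_sandwich)
    show "\<forall>\<^sub>F t in at_right 0. 1 \<le> \<tau> t / t"
      using pos by eventually_elim (use \<tau> in \<open>force simp: field_simps\<close>)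
    show "\<forall>\<^sub>F t in at_right 0. \<tau> t / t \<le> 1 + t"
      using pos
    proof eventually_elim
      case (elim t)
      then have "\<tau> t \<le> (1 + t) * t" using \<tau>[of t] by (simp add: power2_eq_square algebra_simps)
      then show ?case using elim by (simp add: divide_le_eq)
    qed
    show "((\<lambda>t. 1) \<longlongrightarrow> (1::real)) (at_right (0::real))" "((\<lambda>t. 1 + t) \<longlongrightarrow> (1::real)) (at_right 0)"
      by (auto intro!: tendsto_eq_intros)
  qed
  ultimately show thesis using that \<tau> by blast
qed

text \<open>McShane's formula extends \<open>q\<close> with the same Lipschitz constant; additivity and homogeneity
  follow by approximation along sequences.\<close>

lemma dense_Lipschitz_additive_extends:
  fixes q :: "'a::real_normed_vector \<Rightarrow> real"
  assumes add: "\<And>v w. v \<in> V \<Longrightarrow> w \<in> V \<Longrightarrow> v + w \<in> V"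
    and scale: "\<And>c v. c \<in> \<rat> \<Longrightarrow> v \<in> V \<Longrightarrow> c *\<^sub>R v \<in> V"
    and dense: "closure V = UNIV"
    and hom: "\<And>c v. c \<in> \<rat> \<Longrightarrow> v \<in> V \<Longrightarrow> q (c *\<^sub>R v) = c * q v"
    and q_add: "\<And>v w. v \<in> V \<Longrightarrow> w \<in> V \<Longrightarrow> q (v + w) = q v + q w"
    and bound: "\<And>v. v \<in> V \<Longrightarrow> q v \<le> C * norm v" and C: "C \<ge> 0"
  obtains D where "bounded_linear D" "\<And>h v. v \<in> V \<Longrightarrow> \<bar>D h - q v\<bar> \<le> C * norm (h - v)"
proof -
  have neV: "V \<noteq> {}" using dense by auto
  then have zero: "0 \<in> V" using scale[of 0] by auto
  have q0: "q 0 = 0" using hom[of 0 0] zero by simp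
  have Lip: "q v - q u \<le> C * norm (h - u) + C * norm (h - v)" if "v \<in> V" "u \<in> V" for u v h
  proof -
    have "(-1) *\<^sub>R u \<in> V" "q ((-1) *\<^sub>R u) = - q u" using scale[of "-1" u] hom[of "-1" u] that by simp_all
    then have "q v - q u = q (v - u)" "v - u \<in> V"
      using q_add[of v "(-1) *\<^sub>R u"] add[of v "(-1) *\<^sub>R u"] that by simp_all
    then have "q v - q u \<le> C * norm (v - u)" using bound by simp
    also have "norm (v - u) \<le> norm (h - u) + norm (h - v)"
      using norm_triangle_ineq4[of "h - u" "h - v"] by simp
    finally show ?thesis using C by (simp add: mult_left_mono ring_distribs)
  qed
  define D where "D h = (INF v\<in>V. q v + C * norm (h - v))" for h
  have D: "\<bar>D h - q v\<bar> \<le> C * norm (h - v)" if "v \<in> V" for h v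
  proof -
    have low: "q v - C * norm (h - v) \<le> q u + C * norm (h - u)" if "u \<in> V" for u
      using Lip[OF \<open>v \<in> V\<close> that, of h] by simp
    have "D h \<le> q v + C * norm (h - v)"
      unfolding D_def by (rule cINF_lower) (use low that in \<open>auto simp: bdd_below_def\<close>)
    moreover have "q v - C * norm (h - v) \<le> D h"
      unfolding D_def by (rule cINF_greatest) (use low neV in auto)
    ultimately show ?thesis by simp
  qed
  have approx: "\<exists>v. (\<forall>n. v n \<in> V) \<and> v \<longlonglongrightarrow> h" for h
    using dense closure_sequential[of h V] by auto
  have D_lim: "(\<lambda>n. q (v n)) \<longlonglongrightarrow> D h" if "\<And>n. v n \<in> V" "v \<longlonglongrightarrow> h" for v h
  proof -
    have "(\<lambda>n. C * norm (h - v n)) \<longlonglongrightarrow> C * norm (h - h)"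
      by (intro tendsto_intros that)
    then have "(\<lambda>n. C * norm (h - v n)) \<longlonglongrightarrow> 0" by simp
    then have "(\<lambda>n. D h - q (v n)) \<longlonglongrightarrow> 0"
      by (rule Lim_null_comparison[rotated]) (use D that in auto)
    from tendsto_diff[OF tendsto_const[of "D h"] this] show ?thesis by simp
  qed
  have "bounded_linear D"
  proof (rule bounded_linear_intro[of _ C])
    fix h k :: 'a
    obtain v w where vw: "\<And>n. v n \<in> V" "v \<longlonglongrightarrow> h" "\<And>n. w n \<in> V" "w \<longlonglongrightarrow> k"
      using approx[of h] approx[of k] by blast
    have "(\<lambda>n. q (v n + w n)) \<longlonglongrightarrow> D (h + k)"
      by (rule D_lim) (use vw add in \<open>auto intro: tendsto_add\<close>)
    moreover have "(\<lambda>n. q (v n + w n)) \<longlonglongrightarrow> D h + D k"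
      using tendsto_add[OF D_lim[OF vw(1,2)] D_lim[OF vw(3,4)]] q_add vw by simp
    ultimately show "D (h + k) = D h + D k" by (rule LIMSEQ_unique)
  next
    fix c :: real and h :: 'a
    obtain v where v: "\<And>n. v n \<in> V" "v \<longlonglongrightarrow> h" using approx[of h] by blast
    have "c \<in> closure \<rat>" using Rats_closure_real by (metis UNIV_I)
    then obtain a where a: "\<And>n. a n \<in> \<rat>" "a \<longlonglongrightarrow> c" using closure_sequential[of c "\<rat>"] by auto
    have "(\<lambda>n. q (a n *\<^sub>R v n)) \<longlonglongrightarrow> D (c *\<^sub>R h)"
      by (rule D_lim) (use v a scale in \<open>auto intro: tendsto_scaleR\<close>)
    moreover have "(\<lambda>n. q (a n *\<^sub>R v n)) \<longlonglongrightarrow> c * D h"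
      using tendsto_mult[OF a(2) D_lim[OF v]] hom v a by simp
    ultimately have "D (c *\<^sub>R h) = c * D h" by (rule LIMSEQ_unique)
    then show "D (c *\<^sub>R h) = c *\<^sub>R D h" by simp
  next
    fix h show "norm (D h) \<le> norm h * C" using D[OF zero, of h] q0 by (simp add: mult.commute)
  qed
  then show thesis using that D by blast
qed

text \<open>As \<open>f \<le> a\<close> on a ball around the origin, \<open>f\<close> does not decrease, as far as its values exceed
  \<open>a\<close>, when a point near \<open>x\<close> moves in a direction close to \<open>x\<close>. Such directions form a cone with
  interior points, and this monotonicity does everything: it bounds the directional
  derivatives by the one in a direction \<open>e\<close> inside the cone, hence extends them to a bounded
  functional, and it traps \<open>f\<close> in an arbitrary direction, at an arbitrary real increment,
  between values of the hull in directions from \<open>V\<close> at rational increments. Moreover it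
  compares \<open>f\<close> with its hull, so that derivatives of the hull become derivatives of \<open>f\<close>.\<close>

lemma (in bounded_below_function) continuous_gateaux_if_rational_derivatives:
  assumes qc: "quasiconvex f"
    and V_add: "\<And>v w. v \<in> V \<Longrightarrow> w \<in> V \<Longrightarrow> v + w \<in> V"
    and V_scale: "\<And>c v. c \<in> \<rat> \<Longrightarrow> v \<in> V \<Longrightarrow> c *\<^sub>R v \<in> V"
    and V_dense: "closure V = UNIV"
    and r: "r > 0" "\<And>w. norm w < r \<Longrightarrow> f w \<le> a"
    and above: "\<And>h. \<forall>\<^sub>F t in at 0. a \<le> lsc_hull f (x + t *\<^sub>R h)"
    and deriv: "\<And>v. v \<in> V \<Longrightarrow> \<exists>D. has_rational_derivative (lsc_hull f) v D x"
  shows "isCont f x \<and> gateaux_differentiable f x"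
proof -
  let ?g = "lsc_hull f"
  let ?F = "at (0::real) within (\<rat> \<inter> {0<..})"
  have g_qc: "quasiconvex ?g" by (rule quasiconvex_lsc_hull[OF qc])
  obtain e where e: "e \<in> V" "norm (e - x) < r / 4"
    using V_dense r(1) closure_approachable[of x V] by (metis UNIV_I dist_norm zero_less_divide_iff zero_less_numeral)
  \<comment> \<open>Monotonicity along the cone: y lies between y + k and a point w of the ball where f is at most a.\<close>
  have cone: "f y \<le> max (?g (y + k)) a"
    if y: "norm (y - x) < r / 4" and s: "s > 0" and k: "norm (k - s *\<^sub>R e) \<le> s * (r / 4)" for y k s
  proof -
    define w where "w = y - (1 / s) *\<^sub>R k"
    define l where "l = 1 / (1 + s)"
    have l: "0 \<le> l" "l < 1" using s by (simp_all add: l_def)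
    have "norm w < r * (3 / 4)"
    proof -
      have "w = (y - x) - (e - x) - (1 / s) *\<^sub>R (k - s *\<^sub>R e)"
        using s by (simp add: w_def algebra_simps)
      then have "norm w = norm ((y - x) - (e - x) - (1 / s) *\<^sub>R (k - s *\<^sub>R e))" by (rule arg_cong)
      then have "norm w \<le> norm (y - x) + norm (e - x) + norm ((1 / s) *\<^sub>R (k - s *\<^sub>R e))"
        using norm_triangle_ineq4[of "(y - x) - (e - x)" "(1 / s) *\<^sub>R (k - s *\<^sub>R e)"]
          norm_triangle_ineq4[of "y - x" "e - x"] by linarith
      also have "norm ((1 / s) *\<^sub>R (k - s *\<^sub>R e)) = norm (k - s *\<^sub>R e) / s"
        using s by (simp only: norm_scaleR) simp
      also have "\<dots> \<le> r / 4" using k s by (simp add: field_simps)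
      finally show ?thesis using y e(2) by simp
    qed
    then have "f w' \<le> a" if "dist w' w < r / 4" for w'
      using that norm_triangle_ineq[of "w' - w" w] by (intro r(2)) (simp add: dist_norm)
    then have "f (l *\<^sub>R (y + k) + (1 - l) *\<^sub>R w) \<le> max (?g (y + k)) a"
      using r(1) l by (intro quasiconvex_le_max_lsc_hull[OF qc, of "r / 4"]) auto
    moreover have "l *\<^sub>R (y + k) + (1 - l) *\<^sub>R w = y + (l - (1 - l) / s) *\<^sub>R k"
      by (simp add: w_def algebra_simps)
    moreover have "(1 - l) / s = l" using s by (simp add: l_def divide_simps)
    then have "l - (1 - l) / s = 0" by simp
    ultimately show ?thesis by simp
  qed
  have near: "\<forall>\<^sub>F t in at (0::real). norm (x + t *\<^sub>R h - x) < r / 4" for h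
  proof -
    have "((\<lambda>t::real. norm (t *\<^sub>R h)) \<longlongrightarrow> norm ((0::real) *\<^sub>R h)) (at 0)" by (intro tendsto_intros)
    from order_tendstoD(2)[OF this, of "r / 4"] show ?thesis using r(1) by simp
  qed
  have F_le: "?F \<le> at 0" by (rule at_le) simp
  have F_le': "?F \<le> at 0 within \<rat>" by (rule at_le) simp
  have right_le: "at_right (0::real) \<le> at 0" by (rule at_le) simp
  have F_pos: "\<forall>\<^sub>F t in ?F. t > 0" by (simp add: eventually_at_filter)
  have a_le: "a \<le> ?g x" using above[of 0] by (simp add: eventually_const_iff)

  define q where "q v = (SOME D. has_rational_derivative ?g v D x)" for v
  have q: "has_rational_derivative ?g v (q v) x" if "v \<in> V" for v
    unfolding q_def using deriv[OF that] by (rule someI_ex)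
  have q_F: "((\<lambda>t. (?g (x + t *\<^sub>R v) - ?g x) / t) \<longlongrightarrow> q v) ?F" if "v \<in> V" for v
    using tendsto_mono[OF F_le'] q[OF that] unfolding has_rational_derivative_def .
  have q_hom: "q (c *\<^sub>R v) = c * q v" if "c \<in> \<rat>" "v \<in> V" for c v
    using has_rational_derivative_unique[OF q[OF V_scale[OF that]]
      has_rational_derivative_scaleR[OF q[OF that(2)] that(1)]] .
  have q_qc: "q (l *\<^sub>R v + (1 - l) *\<^sub>R w) \<le> max (q v) (q w)"
    if l: "l \<in> \<rat>" "0 \<le> l" "l \<le> 1" and v: "v \<in> V" and w: "w \<in> V" for l v w
  proof (rule tendsto_le[OF at_within_positive_Rats_neq_bot])
    let ?Q = "\<lambda>v t. (?g (x + t *\<^sub>R v) - ?g x) / t"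
    let ?u = "l *\<^sub>R v + (1 - l) *\<^sub>R w"
    have "?u \<in> V" using l v w V_add V_scale by simp
    then show "(?Q ?u \<longlongrightarrow> q ?u) ?F" by (rule q_F)
    show "((\<lambda>t. max (?Q v t) (?Q w t)) \<longlongrightarrow> max (q v) (q w)) ?F"
      by (intro tendsto_max q_F v w)
    show "\<forall>\<^sub>F t in ?F. ?Q ?u t \<le> max (?Q v t) (?Q w t)"
      using F_pos
    proof eventually_elim
      case (elim t)
      have "x + t *\<^sub>R ?u = l *\<^sub>R (x + t *\<^sub>R v) + (1 - l) *\<^sub>R (x + t *\<^sub>R w)"
        by (simp add: algebra_simps)
      then have "?g (x + t *\<^sub>R ?u) \<le> max (?g (x + t *\<^sub>R v)) (?g (x + t *\<^sub>R w))"
        using quasiconvex_max[OF g_qc l(2,3)] by metis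
      then show ?case using elim by (auto simp: le_max_iff_disj divide_le_cancel)
    qed
  qed
  have q_add: "q (v + w) = q v + q w" if "v \<in> V" "w \<in> V" for v w
    by (rule quasiconvex_homogeneous_imp_additive[of V q])
      (use V_add V_scale q_hom q_qc that in auto)
  have q_mono: "q v \<le> c * q e" if v: "v \<in> V" and c: "c \<in> \<rat>" "c > 0" "norm v \<le> c * (r / 4)" for v c
  proof -
    have "q v \<le> q (c *\<^sub>R e)"
    proof (rule tendsto_le[OF at_within_positive_Rats_neq_bot q_F[OF V_scale[OF c(1) e(1)]] q_F[OF v]])
      show "\<forall>\<^sub>F t in ?F. (?g (x + t *\<^sub>R v) - ?g x) / t \<le> (?g (x + t *\<^sub>R (c *\<^sub>R e)) - ?g x) / t"
        using F_pos filter_leD[OF F_le near[of v]] filter_leD[OF F_le above[of "c *\<^sub>R e"]]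
      proof eventually_elim
        case (elim t)
        have "norm (t *\<^sub>R (c *\<^sub>R e - v) - (t * c) *\<^sub>R e) = t * norm v"
          using elim(1) by (simp add: algebra_simps)
        also have "\<dots> \<le> (t * c) * (r / 4)" using elim(1) c(3) by (simp add: mult_left_mono)
        finally have "f (x + t *\<^sub>R v) \<le> max (?g (x + t *\<^sub>R v + t *\<^sub>R (c *\<^sub>R e - v))) a"
          using elim c(2) by (intro cone[of _ "t * c"]) auto
        also have "x + t *\<^sub>R v + t *\<^sub>R (c *\<^sub>R e - v) = x + t *\<^sub>R (c *\<^sub>R e)"
          by (simp add: algebra_simps)
        finally have "?g (x + t *\<^sub>R v) \<le> ?g (x + t *\<^sub>R (c *\<^sub>R e))"
          using lsc_hull_le_self[of "x + t *\<^sub>R v"] elim(3) by simp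
        then show ?case using elim(1) by (simp add: divide_right_mono)
      qed
    qed
    then show ?thesis using q_hom[OF c(1) e(1)] by simp
  qed
  have qe: "q e \<ge> 0"
  proof -
    have "0 \<in> V" using V_scale[of 0 e] e by simp
    from q_mono[OF this, of 1] q_hom[of 0 e] e(1) r(1) show ?thesis by simp
  qed
  \<comment> \<open>The ball of radius r / 4 around e lies in the cone, whence this Lipschitz constant.\<close>
  define C where "C = 4 / r * q e"
  have C: "C \<ge> 0" using qe r(1) by (simp add: C_def)
  have q_bound: "q v \<le> C * norm v" if v: "v \<in> V" for v
  proof (rule ccontr)
    assume "\<not> q v \<le> C * norm v"
    then have less: "4 / r * norm v * q e < q v" by (simp add: C_def mult_ac)
    have K: "norm v \<le> c * (r / 4)" if "4 / r * norm v < c" for c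
      using that r(1) by (simp add: field_simps)
    have K0: "0 \<le> 4 / r * norm v" using r(1) by simp
    show False
    proof (cases "q e = 0")
      case True
      obtain c where "c \<in> \<rat>" "4 / r * norm v < c"
        using Rats_dense_in_real[of "4 / r * norm v" "4 / r * norm v + 1"] by auto
      then have "q v \<le> c * q e" using K K0 by (intro q_mono v) auto
      then show False using True less by simp
    next
      case False
      then have "4 / r * norm v < q v / q e" using less qe by (simp add: less_divide_eq)
      then obtain c where c: "c \<in> \<rat>" "4 / r * norm v < c" "c < q v / q e"
        using Rats_dense_in_real by blast
      then have "q v \<le> c * q e" using K K0 by (intro q_mono v) auto
      then show False using c(3) False qe by (simp add: less_divide_eq)
    qed
  qed
  obtain D where D: "bounded_linear D" "\<And>h v. v \<in> V \<Longrightarrow> \<bar>D h - q v\<bar> \<le> C * norm (h - v)"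
    using dense_Lipschitz_additive_extends[OF V_add V_scale V_dense q_hom q_add q_bound C] by blast

  \<comment> \<open>The function and its hull agree at x, since f x is at most the value of the hull a little further along e.\<close>
  have g_e: "((\<lambda>t. ?g (x + t *\<^sub>R e)) \<longlongrightarrow> ?g x) ?F"
    using tendsto_mono[OF F_le' has_rational_derivative_imp_tendsto[OF q[OF e(1)]]] .
  have fx: "f x = ?g x"
  proof (rule antisym)
    show "f x \<le> ?g x"
    proof (rule tendsto_lowerbound[OF g_e _ at_within_positive_Rats_neq_bot])
      show "\<forall>\<^sub>F t in ?F. f x \<le> ?g (x + t *\<^sub>R e)"
        using F_pos filter_leD[OF F_le above[of e]]
      proof eventually_elim
        case (elim t)
        then have "f x \<le> max (?g (x + t *\<^sub>R e)) a" using r(1) by (intro cone[of _ t]) auto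
        then show ?case using elim(2) by simp
      qed
    qed
  qed (rule lsc_hull_le_self)

  have cont: "isCont f x"
    unfolding isCont_def
  proof (rule order_tendstoI)
    fix b assume b: "b < f x"
    have "x \<in> {y. b < ?g y}" using b fx by simp
    then have "\<forall>\<^sub>F y in at x. y \<in> {y. b < ?g y}"
      using open_lsc_hull_superlevel eventually_at_topological by blast
    then show "\<forall>\<^sub>F y in at x. b < f y"
      by eventually_elim (use lsc_hull_le_self less_le_trans in blast)
  next
    fix b assume b: "f x < b"
    have "\<forall>\<^sub>F t in ?F. 0 < t \<and> ?g (x + t *\<^sub>R e) < b"
      using F_pos order_tendstoD(2)[OF g_e b[unfolded fx]] by eventually_elim simp
    then obtain t where t: "0 < t" "?g (x + t *\<^sub>R e) < b"
      using eventually_happens'[OF at_within_positive_Rats_neq_bot] by blast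
    show "\<forall>\<^sub>F y in at x. f y < b"
      unfolding eventually_at
    proof (intro exI[of _ "min (r / 4) (t * (r / 4))"] conjI ballI impI)
      show "0 < min (r / 4) (t * (r / 4))" using r(1) t(1) by simp
      fix y assume "y \<noteq> x \<and> dist y x < min (r / 4) (t * (r / 4))"
      then have "f y \<le> max (?g (y + (x + t *\<^sub>R e - y))) a"
        using t(1) by (intro cone[of _ t]) (auto simp: dist_norm norm_minus_commute)
      then show "f y < b" using t(2) a_le b fx by simp
    qed
  qed

  obtain \<tau> :: "real \<Rightarrow> real" where \<tau>: "\<And>t. t > 0 \<Longrightarrow> \<tau> t \<in> \<rat> \<and> t < \<tau> t \<and> \<tau> t < t + t\<^sup>2"
    "filterlim \<tau> (at 0 within \<rat>) (at_right 0)" "((\<lambda>t. \<tau> t / t) \<longlongrightarrow> 1) (at_right 0)"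
    using rational_approximation_from_above by blast
  have \<tau>0: "filterlim \<tau> (at 0) (at_right 0)"
    by (rule filterlim_mono[OF \<tau>(2) at_le order_refl]) simp
  have pos: "\<forall>\<^sub>F t in at_right (0::real). 0 < t" by (simp add: eventually_at_right_less)
  have q_\<tau>: "((\<lambda>t. (?g (x + \<tau> t *\<^sub>R v) - ?g x) / t) \<longlongrightarrow> q v) (at_right 0)" if "v \<in> V" for v
  proof -
    have "((\<lambda>t. (?g (x + \<tau> t *\<^sub>R v) - ?g x) / \<tau> t * (\<tau> t / t)) \<longlongrightarrow> q v * 1) (at_right 0)"
      using filterlim_compose[OF q[OF that, unfolded has_rational_derivative_def] \<tau>(2)] \<tau>(3)
      by (rule tendsto_mult)
    then have "((\<lambda>t. (?g (x + \<tau> t *\<^sub>R v) - ?g x) / \<tau> t * (\<tau> t / t)) \<longlongrightarrow> q v) (at_right 0)"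
      by simp
    then show ?thesis
    proof (rule Lim_transform_eventually)
      show "\<forall>\<^sub>F t in at_right 0. (?g (x + \<tau> t *\<^sub>R v) - ?g x) / \<tau> t * (\<tau> t / t) = (?g (x + \<tau> t *\<^sub>R v) - ?g x) / t"
        using pos by eventually_elim (use \<tau>(1) in force)
    qed
  qed

  have right: "((\<lambda>t. (f (x + t *\<^sub>R h) - f x) / t) \<longlongrightarrow> D h) (at_right 0)" for h
  proof -
    \<comment> \<open>It suffices to treat positive increments; the derivative functional is odd.\<close>
    have sandwich: "(\<forall>\<^sub>F t in at_right 0. (f (x + t *\<^sub>R h) - f x) / t < D h + \<epsilon>) \<and>
        (\<forall>\<^sub>F t in at_right 0. D h - \<epsilon> < (f (x + t *\<^sub>R h) - f x) / t)" if \<epsilon>: "\<epsilon> > 0" for \<epsilon>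
    proof -
      have "0 < \<epsilon> / (2 * (q e + 1))" using \<epsilon> qe by simp
      then obtain c where c: "c \<in> \<rat>" "0 < c" "c < \<epsilon> / (2 * (q e + 1))" using Rats_dense_in_real by blast
      have c_eps: "2 * (c * q e) < \<epsilon>"
      proof -
        have "c * (2 * (q e + 1)) < \<epsilon>" using c(3) qe by (simp add: pos_less_divide_eq)
        then show ?thesis using c(2) by (simp add: algebra_simps)
      qed
      have "0 < c * (r / 8)" using c r(1) by simp
      then obtain v where v: "v \<in> V" "norm (v - h) < c * (r / 8)"
        using V_dense closure_approachable[of h V] by (metis UNIV_I dist_norm)
      have "\<bar>D h - q v\<bar> \<le> C * (c * (r / 8))"
        using D(2)[OF v(1), of h] v(2) C by (smt (verit) mult_left_mono norm_minus_commute)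
      also have "\<dots> = c * q e / 2" using r(1) by (simp add: C_def)
      finally have Dq: "\<bar>D h - q v\<bar> \<le> c * q e / 2" .
      \<comment> \<open>Shifting v by a multiple of e covers both the distance from v to h and the rounding of t.\<close>
      define w1 where "w1 = v + c *\<^sub>R e"
      define w2 where "w2 = v + (- c) *\<^sub>R e"
      have mc: "- c \<in> \<rat>" using c(1) by simp
      have w: "w1 \<in> V" "w2 \<in> V" using v(1) e(1) c(1) mc V_add V_scale by (simp_all only: w1_def w2_def)
      have qw: "q w1 = q v + c * q e" "q w2 = q v - c * q e"
        using q_add[OF v(1) V_scale[OF c(1) e(1)]] q_hom[OF c(1) e(1)]
          q_add[OF v(1) V_scale[OF mc e(1)]] q_hom[OF mc e(1)]
        by (simp_all only: w1_def w2_def)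
      have ce: "0 \<le> c * q e" using c qe by simp
      have qw': "q w1 < D h + \<epsilon>" "D h - \<epsilon> < q w2" using qw Dq c_eps ce by linarith+
      have small: "\<forall>\<^sub>F t in at_right 0. t * norm h < c * (r / 8)"
      proof -
        have "((\<lambda>t. t * norm h) \<longlongrightarrow> 0 * norm h) (at_right 0)" by (intro tendsto_intros)
        from order_tendstoD(2)[OF this, of "c * (r / 8)"] show ?thesis using \<open>0 < c * (r / 8)\<close> by simp
      qed
      have est: "norm (\<tau> t *\<^sub>R v - t *\<^sub>R h) \<le> (\<tau> t * c) * (r / 4)"
        if t: "0 < t" "t * norm h < c * (r / 8)" for t
      proof -
        have \<tau>t: "t < \<tau> t" "\<tau> t < t + t\<^sup>2" using \<tau>(1)[OF t(1)] by simp_all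
        have "\<tau> t *\<^sub>R v - t *\<^sub>R h = \<tau> t *\<^sub>R (v - h) + (\<tau> t - t) *\<^sub>R h"
          by (simp add: algebra_simps)
        then have "norm (\<tau> t *\<^sub>R v - t *\<^sub>R h) \<le> \<tau> t * norm (v - h) + (\<tau> t - t) * norm h"
          using norm_triangle_ineq[of "\<tau> t *\<^sub>R (v - h)" "(\<tau> t - t) *\<^sub>R h"] \<tau>t t(1) by simp
        moreover have "\<tau> t * norm (v - h) \<le> \<tau> t * (c * (r / 8))"
          using v(2) \<tau>t t(1) by (intro mult_left_mono) auto
        moreover have "(\<tau> t - t) * norm h \<le> t\<^sup>2 * norm h"
          using \<tau>t by (intro mult_right_mono) auto
        moreover have "t\<^sup>2 * norm h = t * (t * norm h)" by (simp add: power2_eq_square)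
        moreover have "t * (t * norm h) \<le> \<tau> t * (c * (r / 8))"
          by (rule mult_mono) (use t \<tau>t c(2) r(1) in simp_all)
        moreover have "\<tau> t * (c * (r / 8)) + \<tau> t * (c * (r / 8)) = \<tau> t * c * (r / 4)" by simp
        ultimately show ?thesis by linarith
      qed
      have "\<forall>\<^sub>F t in at_right 0. (f (x + t *\<^sub>R h) - f x) / t \<le> (?g (x + \<tau> t *\<^sub>R w1) - ?g x) / t"
        using pos small filter_leD[OF right_le near[of h]]
          eventually_compose_filterlim[OF above[of w1] \<tau>0]
      proof eventually_elim
        case (elim t)
        have \<tau>t: "0 < \<tau> t" using \<tau>(1)[OF elim(1)] elim(1) by simp
        have "(\<tau> t *\<^sub>R w1 - t *\<^sub>R h) - (\<tau> t * c) *\<^sub>R e = \<tau> t *\<^sub>R v - t *\<^sub>R h"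
          by (simp add: w1_def algebra_simps)
        then have "norm ((\<tau> t *\<^sub>R w1 - t *\<^sub>R h) - (\<tau> t * c) *\<^sub>R e) \<le> (\<tau> t * c) * (r / 4)"
          using est[OF elim(1,2)] by (simp only:)
        then have "f (x + t *\<^sub>R h) \<le> max (?g (x + t *\<^sub>R h + (\<tau> t *\<^sub>R w1 - t *\<^sub>R h))) a"
          using elim(3) \<tau>t c(2) by (intro cone[of _ "\<tau> t * c"]) simp_all
        then have "f (x + t *\<^sub>R h) \<le> ?g (x + \<tau> t *\<^sub>R w1)" using elim(4) by simp
        then show ?case using elim(1) fx by (simp add: divide_right_mono)
      qed
      then have up: "\<forall>\<^sub>F t in at_right 0. (f (x + t *\<^sub>R h) - f x) / t < D h + \<epsilon>"
        using order_tendstoD(2)[OF q_\<tau>[OF w(1)] qw'(1)] by eventually_elim simp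
      have "\<forall>\<^sub>F t in at_right 0. (?g (x + \<tau> t *\<^sub>R w2) - ?g x) / t \<le> (f (x + t *\<^sub>R h) - f x) / t"
        using pos small filter_leD[OF right_le above[of h]]
          eventually_compose_filterlim[OF near[of w2] \<tau>0]
      proof eventually_elim
        case (elim t)
        have \<tau>t: "0 < \<tau> t" using \<tau>(1)[OF elim(1)] elim(1) by simp
        have "(t *\<^sub>R h - \<tau> t *\<^sub>R w2) - (\<tau> t * c) *\<^sub>R e = - (\<tau> t *\<^sub>R v - t *\<^sub>R h)"
          by (simp add: w2_def algebra_simps)
        then have "norm ((t *\<^sub>R h - \<tau> t *\<^sub>R w2) - (\<tau> t * c) *\<^sub>R e) \<le> (\<tau> t * c) * (r / 4)"
          using est[OF elim(1,2)] by (simp only: norm_minus_cancel)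
        then have "f (x + \<tau> t *\<^sub>R w2) \<le> max (?g (x + \<tau> t *\<^sub>R w2 + (t *\<^sub>R h - \<tau> t *\<^sub>R w2))) a"
          using elim(4) \<tau>t c(2) by (intro cone[of _ "\<tau> t * c"]) simp_all
        then have "?g (x + \<tau> t *\<^sub>R w2) \<le> f (x + t *\<^sub>R h)"
          using elim(3) lsc_hull_le_self[of "x + \<tau> t *\<^sub>R w2"] lsc_hull_le_self[of "x + t *\<^sub>R h"] by simp
        then show ?case using elim(1) fx by (simp add: divide_right_mono)
      qed
      then have "\<forall>\<^sub>F t in at_right 0. D h - \<epsilon> < (f (x + t *\<^sub>R h) - f x) / t"
        using order_tendstoD(1)[OF q_\<tau>[OF w(2)] qw'(2)] by eventually_elim simp
      with up show ?thesis ..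
    qed
    show ?thesis
    proof (rule order_tendstoI)
      fix b assume "b < D h"
      then show "\<forall>\<^sub>F t in at_right 0. b < (f (x + t *\<^sub>R h) - f x) / t"
        using sandwich[of "D h - b"] by simp
    next
      fix b assume "D h < b"
      then show "\<forall>\<^sub>F t in at_right 0. (f (x + t *\<^sub>R h) - f x) / t < b"
        using sandwich[of "b - D h"] by simp
    qed
  qed
  have "has_gateaux_derivative f (Blinfun D) x"
    unfolding has_gateaux_derivative_def bounded_linear_Blinfun_apply[OF D(1)]
  proof
    fix h
    have "((\<lambda>t. - ((f (x + t *\<^sub>R (- h)) - f x) / t)) \<longlongrightarrow> - D (- h)) (at_right 0)"
      by (intro tendsto_minus right)
    moreover have "- D (- h) = D h" using D(1) by (simp add: bounded_linear.linear linear_neg)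
    ultimately have "((\<lambda>t. (f (x + t *\<^sub>R h) - f x) / t) \<longlongrightarrow> D h) (at_left 0)"
      unfolding filterlim_at_left_to_right by simp
    then show "((\<lambda>t. (f (x + t *\<^sub>R h) - f x) / t) \<longlongrightarrow> D h) (at 0)"
      using right by (rule filterlim_split_at)
  qed
  then show ?thesis using cont unfolding gateaux_differentiable_def by blast
qed

section \<open>Directional null sets\<close>

lemma (in bounded_below_function) le_lsc_hull_if_isCont:
  assumes "isCont f x"
  shows "f x \<le> lsc_hull f x"
proof (rule dense_ge, rule ccontr)
  fix a assume a: "lsc_hull f x < a" "\<not> f x \<le> a"
  then have "\<forall>\<^sub>F y in nhds x. a < f y"
    using assms unfolding isCont_def
    by (simp add: order_tendstoD(1) tendsto_at_iff_tendsto_nhds)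
  then obtain e where e: "e > 0" "\<And>y. dist y x < e \<Longrightarrow> a < f y"
    unfolding eventually_nhds_metric by blast
  obtain y where "f y < a" "dist y x < e"
    using lsc_hull_lessD[OF a(1)] e(1) unfolding closure_approachable by blast
  then show False using e(2)[of y] by simp
qed

lemma interior_sublevel_nonempty_if_isCont:
  fixes f :: "'a::metric_space \<Rightarrow> real"
  assumes "isCont f x" "f x < b"
  shows "interior {y. f y < b} \<noteq> {}"
proof -
  have "\<forall>\<^sub>F y in nhds x. f y < b"
    using assms unfolding isCont_def
    by (simp add: order_tendstoD(2) tendsto_at_iff_tendsto_nhds)
  then have "x \<in> interior {y. f y < b}"
    by (auto simp: eventually_nhds interior_def)
  then show ?thesis by blast
qed

lemma null_along_no_rational_derivative:
  fixes g :: "'a::real_normed_vector \<Rightarrow> real"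
  assumes "quasiconvex g" "g \<in> borel_measurable borel"
  shows "null_along v {x. \<not> (\<exists>D. has_rational_derivative g v D x)}"
  unfolding null_along_def
proof (intro conjI allI)
  show "{x. \<not> (\<exists>D. has_rational_derivative g v D x)} \<in> sets borel"
    by (rule sets_borel_no_rational_derivative[OF assms(2)])
  fix z
  have "(\<lambda>s::real. z + s *\<^sub>R v) \<in> borel_measurable borel"
    by (intro borel_measurable_continuous_onI continuous_intros)
  then have "(\<lambda>s. g (z + s *\<^sub>R v)) \<in> borel_measurable borel"
    using measurable_compose assms(2) by blast
  from quasiconvex_has_rational_derivative_AE[OF quasiconvex_along_line[OF assms(1)] this]
  have "{s. \<not> (\<exists>D. has_rational_derivative (\<lambda>s. g (z + s *\<^sub>R v)) 1 D s)} \<in> null_sets lborel" .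
  moreover have "has_rational_derivative (\<lambda>s. g (z + s *\<^sub>R v)) 1 D s \<longleftrightarrow>
      has_rational_derivative g v D (z + s *\<^sub>R v)" for D s
    by (simp add: has_rational_derivative_def algebra_simps)
  ultimately show "{s. z + s *\<^sub>R v \<in> {x. \<not> (\<exists>D. has_rational_derivative g v D x)}} \<in> null_sets lborel"
    by simp
qed

text \<open>A line in a direction outside the subspace meets it at most once.\<close>

lemma null_along_proper_subspace:
  assumes "N \<in> sets borel" "w \<notin> N"
    and add: "\<And>x y. x \<in> N \<Longrightarrow> y \<in> N \<Longrightarrow> x + y \<in> N"
    and scale: "\<And>c x. x \<in> N \<Longrightarrow> c *\<^sub>R x \<in> N"
  shows "null_along w N"
  unfolding null_along_def
proof (intro conjI allI)
  fix z
  have "s = t" if "z + s *\<^sub>R w \<in> N" "z + t *\<^sub>R w \<in> N" for s t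
  proof (rule ccontr)
    assume "s \<noteq> t"
    have "(1 / (s - t)) *\<^sub>R ((z + s *\<^sub>R w) + (-1) *\<^sub>R (z + t *\<^sub>R w)) \<in> N"
      by (intro scale add that)
    also have "(z + s *\<^sub>R w) + (-1) *\<^sub>R (z + t *\<^sub>R w) = (s - t) *\<^sub>R w"
      by (simp add: algebra_simps)
    finally show False using \<open>s \<noteq> t\<close> assms(2) by simp
  qed
  then have "{s. z + s *\<^sub>R w \<in> N} = {} \<or> (\<exists>t. {s. z + s *\<^sub>R w \<in> N} = {t})" by blast
  then have "countable {s. z + s *\<^sub>R w \<in> N}" by auto
  then show "{s. z + s *\<^sub>R w \<in> N} \<in> null_sets lborel" by (rule countable_imp_null_set_lborel)
qed (rule assms(1))

lemma Baire_countable_closed_union: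
  fixes \<G> :: "'a::{complete_space} set set"
  assumes "countable \<G>" "\<And>C. C \<in> \<G> \<Longrightarrow> closed C \<and> interior C = {}"
  shows "interior (\<Union>\<G>) = {}"
  using Met_TC.metric_Baire_category_alt[of \<G>] assms complete_UNIV by auto

text \<open>Rational scalars keep the linear combinations of a countable dense set countable.\<close>

lemma countable_dense_rational_subspace:
  assumes "separable_space (euclidean :: 'a::real_normed_vector topology)"
  obtains V :: "'a::real_normed_vector set" where "countable V" "closure V = UNIV"
    "\<And>v w. v \<in> V \<Longrightarrow> w \<in> V \<Longrightarrow> v + w \<in> V" "\<And>c v. c \<in> \<rat> \<Longrightarrow> v \<in> V \<Longrightarrow> c *\<^sub>R v \<in> V"
proof -
  obtain C :: "'a set" where C: "countable C" "closure C = UNIV"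
    using assms unfolding separable_space_def by auto
  define comb where "comb xs = (\<Sum>(q, d)\<leftarrow>xs. real_of_rat q *\<^sub>R d)" for xs :: "(rat \<times> 'a) list"
  define V where "V = comb ` lists (UNIV \<times> C)"
  have comb_append: "comb (xs @ ys) = comb xs + comb ys" for xs ys by (simp add: comb_def)
  have comb_scale: "comb (map (\<lambda>(q, d). (c * q, d)) xs) = real_of_rat c *\<^sub>R comb xs" for c xs
    by (induction xs) (auto simp: comb_def of_rat_mult algebra_simps)
  show thesis
  proof (rule that[of V])
    show "countable V" unfolding V_def using C(1) by (intro countable_image countable_lists countable_SIGMA) auto
    have "C \<subseteq> V"
    proof
      fix d assume "d \<in> C"
      then have "[(1, d)] \<in> lists (UNIV \<times> C)" by simp
      then have "comb [(1, d)] \<in> V" unfolding V_def by (rule imageI)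
      then show "d \<in> V" by (simp add: comb_def)
    qed
    then show "closure V = UNIV" using C(2) closure_mono by blast
  next
    fix v w assume "v \<in> V" "w \<in> V"
    then obtain xs ys where *: "v = comb xs" "w = comb ys" "xs \<in> lists (UNIV \<times> C)" "ys \<in> lists (UNIV \<times> C)"
      unfolding V_def by blast
    then have "xs @ ys \<in> lists (UNIV \<times> C)" by simp
    then have "comb (xs @ ys) \<in> V" unfolding V_def by (rule imageI)
    then show "v + w \<in> V" by (simp add: comb_append *)
  next
    fix c :: real and v assume "c \<in> \<rat>" "v \<in> V"
    then obtain xs where "v = comb xs" "xs \<in> lists (UNIV \<times> C)" unfolding V_def by blast
    moreover obtain q where "c = real_of_rat q" using \<open>c \<in> \<rat>\<close> by (rule Rats_cases)
    ultimately have *: "v = comb xs" "xs \<in> lists (UNIV \<times> C)" "c = real_of_rat q" by simp_all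
    have "map (\<lambda>(r, d). (q * r, d)) xs \<in> lists (UNIV \<times> C)"
      using *(2) by (auto simp: in_lists_conv_set)
    then have "comb (map (\<lambda>(r, d). (q * r, d)) xs) \<in> V" unfolding V_def by (rule imageI)
    then show "c *\<^sub>R v \<in> V" by (simp add: comb_scale *)
  qed
qed

section \<open>Quasiconvex functions invariant under a periodic map\<close>

text \<open>Under these assumptions the origin is a minimum of \<open>f\<close>, so \<open>f\<close> is bounded below and its hull
  is available.\<close>

locale periodic_invariant_quasiconvex = periodic_map_without_fixed_point T p
  for T :: "'a::banach \<Rightarrow> 'a" and p +
  fixes f :: "'a \<Rightarrow> real"
  assumes qc: "quasiconvex f"
    and dense_cont: "densely_continuous f"
    and invariant: "f (T x) = f x"
begin

sublocale bounded_below_function f "f 0"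
proof
  fix x
  have "0 \<in> {y. f y \<le> f x}"
    by (rule zero_in_convex_invariant[of _ x]) (auto simp: invariant intro!: quasiconvex_convex_sublevel qc)
  then show "f 0 \<le> f x" by simp
qed

abbreviation g :: "'a \<Rightarrow> real" where "g \<equiv> lsc_hull f"

text \<open>A level is thin if the corresponding closed sublevel set has no interior. These levels
  are the obstruction to cone monotonicity, which at any other level \<open>a\<close> follows from
  \<open>f \<le> a\<close> on a ball around the origin.\<close>

definition thin_levels :: "real set" where
  "thin_levels = {a. interior {x. g x \<le> a} = {}}"

text \<open>By invariance under \<open>T\<close> the multiples by positive integers form a linear subspace already,
  unless there are no points at all.\<close>

definition thin_span :: "'a set" where
  "thin_span = {x. \<exists>n::nat. n > 0 \<and> (\<exists>a\<in>thin_levels. g ((1 / real n) *\<^sub>R x) \<le> a)}"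

lemma continuity_point_in_open: 
  assumes "open U" "U \<noteq> {}"
  obtains x where "x \<in> U" "isCont f x"
  using dense_cont assms unfolding densely_continuous_def
  by (metis (mono_tags, lifting) disjoint_iff inf_top.right_neutral mem_Collect_eq open_Int_closure_eq_empty)

lemma g_sublevel: "convex {x. g x \<le> a}" "T ` {x. g x \<le> a} \<subseteq> {x. g x \<le> a}"
proof -
  show "convex {x. g x \<le> a}"
    by (rule quasiconvex_convex_sublevel[OF quasiconvex_lsc_hull[OF qc]])
  have "g (T x) \<le> g x" for x
    by (rule lsc_hull_invariant) (use bounded_linear linear_continuous_on invariant in auto)
  then show "T ` {x. g x \<le> a} \<subseteq> {x. g x \<le> a}" by (auto intro: order_trans)
qed

lemma thin_levels_downward: "a \<in> thin_levels \<Longrightarrow> b \<le> a \<Longrightarrow> b \<in> thin_levels"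
proof -
  assume a: "a \<in> thin_levels" and "b \<le> a"
  then have "interior {x. g x \<le> b} \<subseteq> interior {x. g x \<le> a}" by (intro interior_mono) auto
  then show ?thesis using a by (auto simp: thin_levels_def)
qed

lemma thin_levels_bdd_above: "bdd_above thin_levels"
proof -
  obtain x where x: "isCont f x" using continuity_point_in_open[OF open_UNIV] by blast
  have "interior {y. f y < f x + 1} \<noteq> {}"
    by (rule interior_sublevel_nonempty_if_isCont[OF x]) simp
  moreover have "{y. f y < f x + 1} \<subseteq> {y. g y \<le> f x + 1}"
    by (auto intro: order_trans[OF lsc_hull_le_self])
  ultimately have "f x + 1 \<notin> thin_levels"
    unfolding thin_levels_def using interior_mono by blast
  then have "a \<le> f x + 1" if "a \<in> thin_levels" for a
    using thin_levels_downward[OF that, of "f x + 1"] by force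
  then show ?thesis by (auto simp: bdd_above_def)
qed

text \<open>Invariance turns an interior point of \<open>{g \<le> a}\<close> into a ball around the origin. For \<open>b > a\<close>
  the convex set \<open>{f < b}\<close> is dense in this ball, and it has interior points because \<open>f\<close> has
  continuity points in the ball; so it contains the ball.\<close>

lemma ball_below_fat_level:
  assumes "a \<notin> thin_levels"
  obtains r where "r > 0" "\<And>w. norm w < r \<Longrightarrow> f w \<le> a"
proof -
  obtain r where r: "r > 0" "ball 0 r \<subseteq> {x. g x \<le> a}"
    using ball_in_convex_invariant[OF g_sublevel[of a]] assms unfolding thin_levels_def by blast
  obtain y where y: "y \<in> ball 0 r" "isCont f y"
    using continuity_point_in_open[OF open_ball, of 0 r] r(1) by (metis centre_in_ball empty_iff)
  then have fy: "f y \<le> a" using le_lsc_hull_if_isCont[OF y(2)] r(2) by force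
  show thesis
  proof (rule that[OF r(1)])
    fix w :: 'a assume w: "norm w < r"
    show "f w \<le> a"
    proof (rule dense_ge)
      fix b assume b: "a < b"
      have "interior {x. f x < b} \<noteq> {}"
        using interior_sublevel_nonempty_if_isCont[OF y(2)] fy b by simp
      moreover have "convex {x. f x < b}" by (rule quasiconvex_convex_sublevel[OF qc])
      moreover have "T ` {x. f x < b} \<subseteq> {x. f x < b}" by (auto simp: invariant)
      ultimately obtain s where s: "s > 0" "ball 0 s \<subseteq> {x. f x < b}"
        using ball_in_convex_invariant by blast
      define l where "l = (norm w + r) / (2 * r)"
      have l: "0 < l" "l < 1" "norm w < l * r" using w r(1) norm_ge_zero[of w]
        by (auto simp: l_def field_simps simp del: norm_ge_zero intro: add_nonneg_pos)
      have "f (l *\<^sub>R ((1 / l) *\<^sub>R w) + (1 - l) *\<^sub>R 0) \<le> max (g ((1 / l) *\<^sub>R w)) b"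
        using s l by (intro quasiconvex_le_max_lsc_hull[OF qc, of s]) force+
      moreover have "g ((1 / l) *\<^sub>R w) \<le> a"
      proof -
        have "norm ((1 / l) *\<^sub>R w) < r" using l by (simp add: field_simps)
        then show ?thesis using r(2) by force
      qed
      ultimately show "f w \<le> b" using l b by simp
    qed
  qed
qed

lemma thin_span_add:
  assumes "x \<in> thin_span" "y \<in> thin_span"
  shows "x + y \<in> thin_span"
proof -
  obtain n a where x: "n > (0::nat)" "a \<in> thin_levels" "g ((1 / real n) *\<^sub>R x) \<le> a"
    using assms(1) unfolding thin_span_def by blast
  obtain k b where y: "k > (0::nat)" "b \<in> thin_levels" "g ((1 / real k) *\<^sub>R y) \<le> b"
    using assms(2) unfolding thin_span_def by blast
  define c where "c = max a b"
  have c: "c \<in> thin_levels" using x y by (simp add: c_def max_def)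
  have "(real n / real (n + k)) *\<^sub>R ((1 / real n) *\<^sub>R x) + (real k / real (n + k)) *\<^sub>R ((1 / real k) *\<^sub>R y)
      \<in> {x. g x \<le> c}"
    using x y by (intro convexD[OF g_sublevel(1)]) (auto simp: c_def add_divide_distrib[symmetric])
  then have "g ((1 / real (n + k)) *\<^sub>R (x + y)) \<le> c"
    using x y by (simp add: scaleR_add_right)
  then show ?thesis using x c unfolding thin_span_def by (auto intro!: exI[of _ "n + k"])
qed

text \<open>For negative factors: an invariant convex set that contains \<open>x\<close> contains \<open>- x / p\<close>.\<close>

lemma thin_span_scaleR:
  assumes "x \<in> thin_span"
  shows "c *\<^sub>R x \<in> thin_span"
proof -
  have nonneg: "c *\<^sub>R x \<in> thin_span" if x: "x \<in> thin_span" and c: "c \<ge> 0" for c x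
  proof -
    obtain n a where n: "n > (0::nat)" "a \<in> thin_levels" "g ((1 / real n) *\<^sub>R x) \<le> a"
      using x unfolding thin_span_def by blast
    obtain k :: nat where k: "max 1 (c * real n) < real k" using reals_Archimedean2 by blast
    then have k0: "k > 0" by (cases k) auto
    let ?l = "c * real n / real k"
    have l: "0 \<le> ?l" "?l \<le> 1" using c k k0 by (auto simp: divide_le_eq)
    have "0 \<in> {x. g x \<le> a}" using zero_in_convex_invariant[OF g_sublevel] n(3) by blast
    then have "?l *\<^sub>R ((1 / real n) *\<^sub>R x) + (1 - ?l) *\<^sub>R 0 \<in> {x. g x \<le> a}"
      using l n by (intro convexD[OF g_sublevel(1)]) auto
    then have "g ((1 / real k) *\<^sub>R (c *\<^sub>R x)) \<le> a" using n(1) by simp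
    then show ?thesis using k0 n(2) unfolding thin_span_def by blast
  qed
  have neg: "- x \<in> thin_span"
  proof -
    obtain n a where n: "n > (0::nat)" "a \<in> thin_levels" "g ((1 / real n) *\<^sub>R x) \<le> a"
      using assms unfolding thin_span_def by blast
    have "(- 1 / real p) *\<^sub>R ((1 / real n) *\<^sub>R x) \<in> {x. g x \<le> a}"
      by (rule neg_in_convex_invariant[OF g_sublevel]) (use n in simp)
    then have "g ((1 / real (n * p)) *\<^sub>R (- x)) \<le> a" by (simp add: mult.commute)
    then show ?thesis using n period unfolding thin_span_def by (auto intro!: exI[of _ "n * p"])
  qed
  show ?thesis
  proof (cases "c \<ge> 0")
    case False
    then show ?thesis using nonneg[OF neg, of "- c"] by simp
  qed (use nonneg assms in blast)
qed

text \<open>The rational thin levels are cofinal among all thin levels, except possibly for a largest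
  one, which is included separately.\<close>

lemma thin_span_countable_union:
  obtains \<G> where "countable \<G>" "\<Union>\<G> = thin_span" "\<And>C. C \<in> \<G> \<Longrightarrow> closed C \<and> interior C = {}"
proof -
  define L where "L = thin_levels \<inter> (\<rat> \<union> {Sup thin_levels})"
  have L: "\<exists>b\<in>L. a \<le> b" if a: "a \<in> thin_levels" for a
  proof (cases "a = Sup thin_levels")
    case True
    then show ?thesis using a by (auto simp: L_def)
  next
    case False
    then have "a < Sup thin_levels" using cSup_upper[OF a thin_levels_bdd_above] by simp
    then obtain c where c: "c \<in> thin_levels" "a < c"
      using less_cSup_iff[OF _ thin_levels_bdd_above] a by blast
    obtain b where b: "b \<in> \<rat>" "a < b" "b < c" using c(2) Rats_dense_in_real by blast
    then have "b \<in> L" using thin_levels_downward[OF c(1)] by (auto simp: L_def)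
    then show ?thesis using b(2) by (intro bexI[OF _ \<open>b \<in> L\<close>]) simp
  qed
  define piece where "piece = (\<lambda>(n::nat, a). {x. g ((1 / real n) *\<^sub>R x) \<le> a})"
  define \<G> where "\<G> = piece ` ({0<..} \<times> L)"
  show thesis
  proof (rule that[of \<G>])
    have "countable L" unfolding L_def using countable_rat by (intro countable_Int2) auto
    then show "countable \<G>" unfolding \<G>_def by (intro countable_image countable_SIGMA) auto
    show "\<Union>\<G> = thin_span"
    proof (intro equalityI subsetI)
      fix x assume "x \<in> \<Union>\<G>"
      then show "x \<in> thin_span" unfolding \<G>_def piece_def thin_span_def L_def by auto
    next
      fix x assume "x \<in> thin_span"
      then obtain n a where n: "n > (0::nat)" "a \<in> thin_levels" "g ((1 / real n) *\<^sub>R x) \<le> a"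
        unfolding thin_span_def by blast
      obtain b where "b \<in> L" "a \<le> b" using L[OF n(2)] by blast
      then have "x \<in> piece (n, b)" "(n, b) \<in> {0<..} \<times> L" using n by (auto simp: piece_def)
      then show "x \<in> \<Union>\<G>" unfolding \<G>_def by blast
    qed
    fix C assume "C \<in> \<G>"
    then obtain n a where n: "n > (0::nat)" "a \<in> thin_levels" and C: "C = piece (n, a)"
      unfolding \<G>_def L_def by auto
    have C': "C = (\<lambda>x. (1 / real n) *\<^sub>R x) -` {x. g x \<le> a}" by (auto simp: C piece_def)
    have "closed C" unfolding C'
      by (intro closed_vimage closed_lsc_hull_sublevel continuous_intros)
    moreover have "interior C = {}"
    proof (rule ccontr)
      assume "interior C \<noteq> {}"
      then obtain x e where e: "e > 0" "ball x e \<subseteq> C" by (auto simp: mem_interior)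
      have "ball ((1 / real n) *\<^sub>R x) (e / real n) \<subseteq> {x. g x \<le> a}"
      proof
        fix y assume y: "y \<in> ball ((1 / real n) *\<^sub>R x) (e / real n)"
        have "dist x (real n *\<^sub>R y) = real n * dist ((1 / real n) *\<^sub>R x) y"
        proof -
          have "x - real n *\<^sub>R y = real n *\<^sub>R ((1 / real n) *\<^sub>R x - y)"
            using n by (simp add: algebra_simps)
          then show ?thesis by (simp add: dist_norm)
        qed
        also have "\<dots> < e" using y n by (simp add: field_simps)
        finally have "real n *\<^sub>R y \<in> C" using e(2) by auto
        then show "y \<in> {x. g x \<le> a}" using n by (simp add: C')
      qed
      then have "(1 / real n) *\<^sub>R x \<in> interior {x. g x \<le> a}"
        unfolding mem_interior using e(1) n(1) by (intro exI[of _ "e / real n"]) simp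
      then show False using n(2) by (simp add: thin_levels_def)
    qed
    ultimately show "closed C \<and> interior C = {}" ..
  qed
qed

text \<open>A countable union of closed sets without interior points is not the whole space.\<close>

lemma thin_span_null_along:
  obtains w where "w \<notin> thin_span" "null_along w thin_span"
proof -
  obtain \<G> where \<G>: "countable \<G>" "\<Union>\<G> = thin_span" "\<And>C. C \<in> \<G> \<Longrightarrow> closed C \<and> interior C = {}"
    using thin_span_countable_union by blast
  have "interior thin_span = {}"
    using Baire_countable_closed_union[OF \<G>(1,3)] \<G>(2) by simp
  then have "thin_span \<noteq> UNIV" by auto
  then obtain w where w: "w \<notin> thin_span" by blast
  have "thin_span \<in> sets borel"
    unfolding \<G>(2)[symmetric] using \<G>(1,3) by (intro sets.countable_Union) auto
  then have "null_along w thin_span"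
    using w thin_span_add thin_span_scaleR by (rule null_along_proper_subspace)
  then show thesis using that w by blast
qed

text \<open>If some level below \<open>g x\<close> is not thin, semicontinuity of the hull keeps \<open>g\<close> above it near
  \<open>x\<close>. Otherwise \<open>g x\<close> itself is the smallest level that is not thin; then \<open>g\<close> can drop below
  \<open>g x\<close> only inside the subspace spanned by the thin sublevel sets, which each line through \<open>x\<close>
  meets at most once.\<close>

lemma fat_level_below:
  assumes x: "x \<notin> thin_span"
  obtains a where "a \<notin> thin_levels" "\<And>h. \<forall>\<^sub>F t in at 0. a \<le> g (x + t *\<^sub>R h)"
proof -
  have not_thin: "g y \<notin> thin_levels" if "y \<notin> thin_span" for y
  proof
    assume "g y \<in> thin_levels"
    then have "y \<in> thin_span"
      unfolding thin_span_def by (intro CollectI exI[of _ 1] conjI bexI[of _ "g y"]) simp_all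
    then show False using that by contradiction
  qed
  show thesis
  proof (cases "\<exists>a. a \<notin> thin_levels \<and> a < g x")
    case True
    then obtain a where a: "a \<notin> thin_levels" "a < g x" by blast
    have "\<forall>\<^sub>F t in at 0. a \<le> g (x + t *\<^sub>R h)" for h
    proof -
      have "((\<lambda>t. x + t *\<^sub>R h) \<longlongrightarrow> x + 0 *\<^sub>R h) (at 0)" by (intro tendsto_intros)
      then have "((\<lambda>t. x + t *\<^sub>R h) \<longlongrightarrow> x) (at 0)" by simp
      from topological_tendstoD[OF this open_lsc_hull_superlevel[of a]] a(2)
      show ?thesis by (auto elim: eventually_mono)
    qed
    then show thesis using that a(1) by blast
  next
    case False
    have "\<forall>\<^sub>F t in at 0. g x \<le> g (x + t *\<^sub>R h)" for h
    proof -
      have single: "s = t" if "x + s *\<^sub>R h \<in> thin_span" "x + t *\<^sub>R h \<in> thin_span" for s t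
      proof (rule ccontr)
        assume "s \<noteq> t"
        have "(1 / (s - t)) *\<^sub>R ((x + s *\<^sub>R h) + (-1) *\<^sub>R (x + t *\<^sub>R h)) \<in> thin_span"
          by (intro thin_span_scaleR thin_span_add that)
        also have "(x + s *\<^sub>R h) + (-1) *\<^sub>R (x + t *\<^sub>R h) = (s - t) *\<^sub>R h"
          by (simp add: algebra_simps)
        finally have "h \<in> thin_span" using \<open>s \<noteq> t\<close> by simp
        then have "(x + s *\<^sub>R h) + (- s) *\<^sub>R h \<in> thin_span"
          using thin_span_add[OF that(1) thin_span_scaleR] by blast
        then show False using x by simp
      qed
      have "\<forall>\<^sub>F t in at 0. x + t *\<^sub>R h \<notin> thin_span"
      proof (cases "\<exists>s. x + s *\<^sub>R h \<in> thin_span")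
        case True
        then obtain s where s: "x + s *\<^sub>R h \<in> thin_span" by blast
        then have "s \<noteq> 0" using x by auto
        have "x + t *\<^sub>R h \<notin> thin_span" if "dist t 0 < \<bar>s\<bar>" for t
          using single[OF s, of t] that by auto
        then show ?thesis using \<open>s \<noteq> 0\<close> unfolding eventually_at by (intro exI[of _ "\<bar>s\<bar>"]) auto
      qed simp
      then show ?thesis
      proof eventually_elim
        case (elim t)
        then show ?case using not_thin False by (meson not_less)
      qed
    qed
    then show thesis using that not_thin[OF x] by blast
  qed
qed

theorem continuous_gateaux_off_haar_null:
  assumes "separable_space (euclidean :: 'a topology)"
  obtains N where "haar_null N" "\<And>x. x \<notin> N \<Longrightarrow> isCont f x \<and> gateaux_differentiable f x"
proof -
  obtain V :: "'a set" where V: "countable V" "closure V = UNIV"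
    "\<And>v w. v \<in> V \<Longrightarrow> w \<in> V \<Longrightarrow> v + w \<in> V" "\<And>c v. c \<in> \<rat> \<Longrightarrow> v \<in> V \<Longrightarrow> c *\<^sub>R v \<in> V"
    using countable_dense_rational_subspace[OF assms] by metis
  obtain w0 where w0: "w0 \<notin> thin_span" "null_along w0 thin_span"
    using thin_span_null_along by blast
  define B where "B v = {x. \<not> (\<exists>D. has_rational_derivative g v D x)}" for v
  have B: "null_along v (B v)" for v
    unfolding B_def by (rule null_along_no_rational_derivative[OF quasiconvex_lsc_hull[OF qc] borel_lsc_hull])
  define w where "w n = (case n of 0 \<Rightarrow> w0 | Suc k \<Rightarrow> from_nat_into V k)" for n
  define A where "A n = (case n of 0 \<Rightarrow> thin_span | Suc k \<Rightarrow> B (from_nat_into V k))" for n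
  have "haar_null (\<Union>n. A n)"
    by (rule haar_null_UN_null_along[of w]) (use w0 B in \<open>auto simp: w_def A_def split: nat.split\<close>)
  moreover have "isCont f x \<and> gateaux_differentiable f x" if x: "x \<notin> (\<Union>n. A n)" for x
  proof -
    have "x \<notin> A 0" using x by blast
    then have "x \<notin> thin_span" by (simp add: A_def)
    then obtain a where a: "a \<notin> thin_levels" "\<And>h. \<forall>\<^sub>F t in at 0. a \<le> g (x + t *\<^sub>R h)"
      using fat_level_below by blast
    obtain r where r: "r > 0" "\<And>w. norm w < r \<Longrightarrow> f w \<le> a" using ball_below_fat_level[OF a(1)] by blast
    have deriv: "\<exists>D. has_rational_derivative g v D x" if v: "v \<in> V" for v
    proof -
      obtain k where "from_nat_into V k = v" using from_nat_into_surj[OF V(1) v] by blast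
      moreover have "x \<notin> A (Suc k)" using x by blast
      ultimately show ?thesis by (simp add: A_def B_def)
    qed
    show ?thesis
      by (rule continuous_gateaux_if_rational_derivatives[OF qc V(3,4,2) r a(2) deriv])
  qed
  ultimately show thesis using that by blast
qed

end

theorem corollary6p6:
  fixes f :: "'a::banach \<Rightarrow> real" and T :: "'a \<Rightarrow> 'a" and p :: nat
  assumes separable: "separable_space (euclidean :: 'a topology)"
    and quasiconvex: "quasiconvex f"
    and dense_cont: "densely_continuous f"
    and T_bounded_linear: "bounded_linear T"
    and p_gt_1: "p > 1"
    and T_periodic: "T ^^ p = id"
    and one_not_eigenvalue: "\<not> (\<exists>x. x \<noteq> 0 \<and> T x = x)"
    and f_invariant: "\<And>x. f (T x) = f x"
  shows "closure {x. isCont f x \<and> gateaux_differentiable f x} = UNIV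
    \<and> (reflexive_space TYPE('a) \<longrightarrow>
         (\<exists>N. haar_null N \<and> (\<forall>x\<in>UNIV - N. isCont f x \<and> gateaux_differentiable f x)))"
proof -
  interpret periodic_invariant_quasiconvex T p f
    by (intro periodic_invariant_quasiconvex.intro periodic_map_without_fixed_point.intro
        periodic_invariant_quasiconvex_axioms.intro) (use assms in auto)
  obtain N where N: "haar_null N" "\<And>x. x \<notin> N \<Longrightarrow> isCont f x \<and> gateaux_differentiable f x"
    using continuous_gateaux_off_haar_null[OF separable] by blast
  have "closure (- N) \<subseteq> closure {x. isCont f x \<and> gateaux_differentiable f x}"
    by (rule closure_mono) (use N(2) in auto)
  then have "closure {x. isCont f x \<and> gateaux_differentiable f x} = UNIV"
    using haar_null_complement_dense[OF separable N(1)] by blast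
  then show ?thesis using N by blast
qed

end
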